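(* Let $G$ be a finite group and $H \le G$ a subgroup. Let $w$ be an irreducible weight on $G$ and let $\alpha$ be a probability distribution on $G$. The Markov chain $\mathrm{MC}(\alpha,w)$ lumps weakly to $G/H$ if and only if $L_{\alpha,w}(1-\eta_H)w \subseteq L_{\alpha,w}(1-\eta_H)$.
   Context: A weight on $G$ is a function $w : G \to \mathbb{R}_{\ge 0}$ that is not identically zero; write $w(K) = \sum_{g\in K} w(g)$ for $K\subseteq G$. Functions $x: G \to \mathbb{C}$ are identified with elements $\sum_g x(g) g \in \mathbb{C}[G]$. The weight $w$ is irreducible if its support generates $G$. $\mathrm{MC}(\alpha,w)$ is the time-homogeneous Markov chain $(X_t)_{t\ge 0}$ on $G$ with $X_0$ distributed as $\alpha$ and $\mathbb{P}[X_{t+1} = xg \mid X_t = x] = w(g)/w(G)$. It lumps weakly to $G/H$ if $(X_tH)_{t\ge 0}$ is a time-homogeneous Markov chain on the set $G/H$ of left cosets. For a non-empty $K \subseteq G$, $\eta_K = |K|^{-1}\sum_{g\in K} g$. Let $\pi_H : \mathbb{C}[G]\to\mathbb{C}[H]$ be the projection $\sum_{g\in G} x(g) g \mapsto \sum_{g\in H} x(g) g$. A left ideal $L$ of $\mathbb{C}[G]$ is induced (from $H$ to $G$) if $\pi_H(L)\subseteq L$. A Gurvits--Ledoux ideal for $w$ is an induced left ideal $L$ of $\mathbb{C}[G]$ such that $\eta_G \in L$ and $Lw\subseteq L$. $L_{\alpha,w}$ denotes the minimal Gurvits--Ledoux ideal for $w$ containing $\alpha$, i.e. the intersection of all Gurvits--Ledoux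 ideals for $w$ containing $\alpha$. *)

theory Defs
  imports "HOL-Algebra.Ideal" "HOL-Algebra.Left_Coset" "HOL-Algebra.Generated_Groups" "HOL-Probability.Probability"
begin

section \<open>The group algebra and its left ideals\<close>

text \<open>Elements of the group algebra of a finite group over the complex numbers are functions
  vanishing outside the carrier; multiplication is convolution.\<close>

definition group_algebra :: "('a, 'b) monoid_scheme \<Rightarrow> ('a \<Rightarrow> complex) ring"
  where "group_algebra G =
    \<lparr>carrier = {f. \<forall>x. x \<notin> carrier G \<longrightarrow> f x = 0},
     monoid.mult = (\<lambda>f g x. if x \<in> carrier G
                then \<Sum>y\<in>carrier G. f y * g (inv\<^bsub>G\<^esub> y \<otimes>\<^bsub>G\<^esub> x) else 0),
     monoid.one = (\<lambda>x. if x = \<one>\<^bsub>G\<^esub> then 1 else 0),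
     ring.zero = (\<lambda>x. 0),
     ring.add = (\<lambda>f g x. f x + g x)\<rparr>"

definition algebra_elem :: "('a, 'b) monoid_scheme \<Rightarrow> ('a \<Rightarrow> real) \<Rightarrow> 'a \<Rightarrow> complex"
  where "algebra_elem G f = (\<lambda>x. if x \<in> carrier G then complex_of_real (f x) else 0)"

definition eta :: "'a set \<Rightarrow> 'a \<Rightarrow> complex"
  where "eta K = (\<lambda>x. if x \<in> K then 1 / of_nat (card K) else 0)"

text \<open>The projection onto the subalgebra spanned by \<open>H\<close>, regarded as a map of the group
  algebra of \<open>G\<close> to itself.\<close>

definition subgroup_proj :: "'a set \<Rightarrow> ('a \<Rightarrow> complex) \<Rightarrow> 'a \<Rightarrow> complex"
  where "subgroup_proj H f = (\<lambda>x. if x \<in> H then f x else 0)"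

text \<open>Closure under scalars is part of absorption, since scalars embed in the group algebra
  as multiples of its unit.\<close>

locale left_ideal = additive_subgroup I R + ring R for I and R (structure) +
  assumes I_l_closed: "\<lbrakk>a \<in> I; x \<in> carrier R\<rbrakk> \<Longrightarrow> x \<otimes> a \<in> I"

definition induced_from :: "'a set \<Rightarrow> ('a \<Rightarrow> complex) set \<Rightarrow> bool"
  where "induced_from H L \<longleftrightarrow> subgroup_proj H ` L \<subseteq> L"

definition gurvits_ledoux_ideal ::
    "('a, 'b) monoid_scheme \<Rightarrow> 'a set \<Rightarrow> ('a \<Rightarrow> real) \<Rightarrow> ('a \<Rightarrow> complex) set \<Rightarrow> bool"
  where "gurvits_ledoux_ideal G H w L \<longleftrightarrow>
    left_ideal L (group_algebra G) \<and> induced_from H L \<and>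
    eta (carrier G) \<in> L \<and> L #>\<^bsub>group_algebra G\<^esub> algebra_elem G w \<subseteq> L"

definition min_gl_ideal ::
    "('a, 'b) monoid_scheme \<Rightarrow> 'a set \<Rightarrow> ('a \<Rightarrow> real) \<Rightarrow> ('a \<Rightarrow> real) \<Rightarrow> ('a \<Rightarrow> complex) set"
  where "min_gl_ideal G H \<alpha> w =
    \<Inter>{L. gurvits_ledoux_ideal G H w L \<and> algebra_elem G \<alpha> \<in> L}"


section \<open>Weights, Markov chains and weak lumping\<close>

definition weight :: "('a, 'b) monoid_scheme \<Rightarrow> ('a \<Rightarrow> real) \<Rightarrow> bool"
  where "weight G w \<longleftrightarrow> (\<forall>g\<in>carrier G. 0 \<le> w g) \<and> (\<exists>g\<in>carrier G. w g \<noteq> 0)"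

definition irreducible_weight :: "('a, 'b) monoid_scheme \<Rightarrow> ('a \<Rightarrow> real) \<Rightarrow> bool"
  where "irreducible_weight G w \<longleftrightarrow>
    weight G w \<and> generate G {g \<in> carrier G. w g \<noteq> 0} = carrier G"

definition distribution_on :: "('a, 'b) monoid_scheme \<Rightarrow> ('a \<Rightarrow> real) \<Rightarrow> bool"
  where "distribution_on G \<alpha> \<longleftrightarrow> (\<forall>g\<in>carrier G. 0 \<le> \<alpha> g) \<and> (\<Sum>g\<in>carrier G. \<alpha> g) = 1"

text \<open>A time-homogeneous Markov chain with finite state space \<open>S\<close> and transition matrix \<open>P\<close>.
  The Markov property is only required for histories of positive probability, so rows of \<open>P\<close>
  belonging to states that are never visited are arbitrary.\<close>

locale homogeneous_markov_chain = prob_space M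
  for M :: "'m measure" and S :: "'s set" and P :: "'s \<Rightarrow> 's \<Rightarrow> real"
    and Z :: "nat \<Rightarrow> 'm \<Rightarrow> 's" +
  assumes finite_states: "finite S"
    and measurable_Z: "Z t \<in> measurable M (count_space S)"
    and P_nonneg: "\<lbrakk>x \<in> S; y \<in> S\<rbrakk> \<Longrightarrow> 0 \<le> P x y"
    and P_sum: "x \<in> S \<Longrightarrow> (\<Sum>y\<in>S. P x y) = 1"
    and markov: "\<lbrakk>\<P>(\<omega> in M. \<forall>i\<le>t. Z i \<omega> = h i) > 0; y \<in> S\<rbrakk> \<Longrightarrow>
      \<P>(\<omega> in M. Z (Suc t) \<omega> = y \<bar> \<forall>i\<le>t. Z i \<omega> = h i) = P (h t) y"

text \<open>\<open>is_MC G \<alpha> w M Z\<close>: the process \<open>Z\<close> on the probability space \<open>M\<close> is a realisation of the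
  left-invariant random walk with initial distribution \<open>\<alpha>\<close> and weight \<open>w\<close>; the step from \<open>x\<close> to
  \<open>y\<close> is right multiplication by the group element \<open>inv x \<otimes> y\<close>.\<close>

definition is_MC :: "('a, 'b) monoid_scheme \<Rightarrow> ('a \<Rightarrow> real) \<Rightarrow> ('a \<Rightarrow> real) \<Rightarrow>
    'm measure \<Rightarrow> (nat \<Rightarrow> 'm \<Rightarrow> 'a) \<Rightarrow> bool"
  where "is_MC G \<alpha> w M Z \<longleftrightarrow>
    homogeneous_markov_chain M (carrier G)
      (\<lambda>x y. w (inv\<^bsub>G\<^esub> x \<otimes>\<^bsub>G\<^esub> y) / (\<Sum>g\<in>carrier G. w g)) Z \<and>
    (\<forall>x\<in>carrier G. \<P>(\<omega> in M. Z 0 \<omega> = x) = \<alpha> x)"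

definition lumps_weakly ::
    "('a, 'b) monoid_scheme \<Rightarrow> 'a set \<Rightarrow> 'm measure \<Rightarrow> (nat \<Rightarrow> 'm \<Rightarrow> 'a) \<Rightarrow> bool"
  where "lumps_weakly G H M Z \<longleftrightarrow>
    (\<exists>Q. homogeneous_markov_chain M (lcosets\<^bsub>G\<^esub> H) Q (\<lambda>t \<omega>. Z t \<omega> <#\<^bsub>G\<^esub> H))"


section \<open>The group algebra is a ring, and the chain exists\<close>

lemma (in group) sum_l_translate:
  assumes "finite (carrier G)" "z \<in> carrier G"
  shows "(\<Sum>y\<in>carrier G. F (z \<otimes> y)) = (\<Sum>y\<in>carrier G. F y)"
  by (rule sum.reindex_bij_witness[where j="\<lambda>y. z \<otimes> y" and i="\<lambda>y. inv z \<otimes> y"])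
     (use assms in \<open>auto simp: m_assoc[symmetric]\<close>)

lemma (in group) ring_group_algebra:
  assumes fin: "finite (carrier G)"
  shows "ring (group_algebra G)"
proof (rule ringI)
  show "abelian_group (group_algebra G)"
  proof (rule abelian_groupI)
    fix f assume "f \<in> carrier (group_algebra G)"
    then show "\<exists>g\<in>carrier (group_algebra G). g \<oplus>\<^bsub>group_algebra G\<^esub> f = \<zero>\<^bsub>group_algebra G\<^esub>"
      by (intro bexI[of _ "\<lambda>x. - f x"]) (auto simp: group_algebra_def)
  qed (auto simp: group_algebra_def add_ac)
next
  have assoc: "(\<Sum>y\<in>carrier G. (\<Sum>z\<in>carrier G. f z * g (inv z \<otimes> y)) * h (inv y \<otimes> x))
      = (\<Sum>z\<in>carrier G. f z * (\<Sum>u\<in>carrier G. g u * h (inv u \<otimes> (inv z \<otimes> x))))"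
    if x: "x \<in> carrier G" for f g h :: "'a \<Rightarrow> complex" and x
  proof -
    have "(\<Sum>y\<in>carrier G. (\<Sum>z\<in>carrier G. f z * g (inv z \<otimes> y)) * h (inv y \<otimes> x))
        = (\<Sum>z\<in>carrier G. f z * (\<Sum>y\<in>carrier G. g (inv z \<otimes> y) * h (inv y \<otimes> x)))"
      unfolding sum_distrib_left sum_distrib_right mult.assoc by (rule sum.swap)
    also have "\<dots> = (\<Sum>z\<in>carrier G. f z * (\<Sum>u\<in>carrier G. g u * h (inv u \<otimes> (inv z \<otimes> x))))"
    proof (rule sum.cong[OF refl], rule arg_cong2[where f="(*)", OF refl])
      fix z assume z: "z \<in> carrier G"
      have "(\<Sum>y\<in>carrier G. g (inv z \<otimes> y) * h (inv y \<otimes> x))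
          = (\<Sum>u\<in>carrier G. g (inv z \<otimes> (z \<otimes> u)) * h (inv (z \<otimes> u) \<otimes> x))"
        by (rule sum_l_translate[OF fin z, symmetric])
      also have "\<dots> = (\<Sum>u\<in>carrier G. g u * h (inv u \<otimes> (inv z \<otimes> x)))"
      proof (rule sum.cong[OF refl])
        fix u assume u: "u \<in> carrier G"
        have "inv z \<otimes> (z \<otimes> u) = u" and "inv (z \<otimes> u) \<otimes> x = inv u \<otimes> (inv z \<otimes> x)"
          using z u x by (simp_all add: inv_mult_group m_assoc flip: m_assoc[of "inv z" z u])
        then show "g (inv z \<otimes> (z \<otimes> u)) * h (inv (z \<otimes> u) \<otimes> x) = g u * h (inv u \<otimes> (inv z \<otimes> x))"
          by simp
      qed
      finally show "(\<Sum>y\<in>carrier G. g (inv z \<otimes> y) * h (inv y \<otimes> x))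
          = (\<Sum>u\<in>carrier G. g u * h (inv u \<otimes> (inv z \<otimes> x)))" .
    qed
    finally show ?thesis .
  qed
  have l1: "(\<Sum>y\<in>carrier G. (if y = \<one> then 1 else 0) * f (inv y \<otimes> x)) = f x"
    if "x \<in> carrier G" for f :: "'a \<Rightarrow> complex" and x
  proof -
    have "(\<Sum>y\<in>carrier G. (if y = \<one> then 1 else 0) * f (inv y \<otimes> x))
        = (\<Sum>y\<in>carrier G. if y = \<one> then f x else 0)"
      by (rule sum.cong) (use that in auto)
    then show ?thesis using fin by simp
  qed
  have r1: "(\<Sum>y\<in>carrier G. f y * (if inv y \<otimes> x = \<one> then 1 else 0)) = f x"
    if "x \<in> carrier G" for f :: "'a \<Rightarrow> complex" and x
  proof -
    have "inv y \<otimes> x = \<one> \<longleftrightarrow> y = x" if "y \<in> carrier G" for y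
      using that \<open>x \<in> carrier G\<close> inv_solve_left'[of "\<one>" y x] by auto
    then have "(\<Sum>y\<in>carrier G. f y * (if inv y \<otimes> x = \<one> then 1 else 0))
        = (\<Sum>y\<in>carrier G. if y = x then f x else 0)"
      by (intro sum.cong) auto
    then show ?thesis using fin that by simp
  qed
  show "monoid (group_algebra G)"
  proof (rule monoidI)
    fix f g h assume "f \<in> carrier (group_algebra G)" "g \<in> carrier (group_algebra G)"
      "h \<in> carrier (group_algebra G)"
    show "(f \<otimes>\<^bsub>group_algebra G\<^esub> g) \<otimes>\<^bsub>group_algebra G\<^esub> h
        = f \<otimes>\<^bsub>group_algebra G\<^esub> (g \<otimes>\<^bsub>group_algebra G\<^esub> h)"
    proof (rule ext)
      fix x
      show "((f \<otimes>\<^bsub>group_algebra G\<^esub> g) \<otimes>\<^bsub>group_algebra G\<^esub> h) x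
        = (f \<otimes>\<^bsub>group_algebra G\<^esub> (g \<otimes>\<^bsub>group_algebra G\<^esub> h)) x"
        using assoc[of x f g h] by (simp add: group_algebra_def)
    qed
  next
    fix f assume "f \<in> carrier (group_algebra G)"
    then show "\<one>\<^bsub>group_algebra G\<^esub> \<otimes>\<^bsub>group_algebra G\<^esub> f = f"
      and "f \<otimes>\<^bsub>group_algebra G\<^esub> \<one>\<^bsub>group_algebra G\<^esub> = f"
      using l1[of _ f] r1[of _ f] by (auto simp: group_algebra_def fun_eq_iff)
  qed (auto simp: group_algebra_def)
qed (simp_all add: group_algebra_def fun_eq_iff distrib_left distrib_right sum.distrib)

lemma (in group) MC_exists:
  assumes fin: "finite (carrier G)" and w: "weight G w" and \<alpha>: "distribution_on G \<alpha>"
  shows "\<exists>(M :: (nat \<Rightarrow> 'a) measure) Z. is_MC G \<alpha> w M Z"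
proof -
  define W where "W = (\<Sum>g\<in>carrier G. w g)"
  have w0: "\<And>g. g \<in> carrier G \<Longrightarrow> 0 \<le> w g" and \<alpha>0: "\<And>g. g \<in> carrier G \<Longrightarrow> 0 \<le> \<alpha> g"
    and \<alpha>1: "(\<Sum>g\<in>carrier G. \<alpha> g) = 1"
    using w \<alpha> by (auto simp: weight_def distribution_on_def)
  have W: "W > 0"
    using w fin w0 by (force simp: weight_def W_def less_le sum_nonneg sum_nonneg_eq_0_iff)
  define p where "p = (\<lambda>i::nat. \<lambda>g. if i = 0 then \<alpha> g else w g / W)"
  have p0: "0 \<le> p i g" if "g \<in> carrier G" for i g
    using that w0 \<alpha>0 W by (auto simp: p_def)
  have p1: "(\<Sum>g\<in>carrier G. p i g) = 1" for i
    using W \<alpha>1 by (cases "i = 0") (auto simp: p_def W_def simp flip: sum_divide_distrib)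
  define D where "D = (\<lambda>i. point_measure (carrier G) (\<lambda>g. ennreal (p i g)))"
  have spD: "space (D i) = carrier G" and seD: "sets (D i) = Pow (carrier G)" for i
    by (auto simp: D_def space_point_measure sets_point_measure)
  have eD: "emeasure (D i) {g} = ennreal (p i g)" if "g \<in> carrier G" for i g
    using that fin by (simp add: D_def emeasure_point_measure_finite)
  have prD: "prob_space (D i)" for i
    unfolding D_def by (rule prob_space_point_measure) (use fin p0 p1 in auto)
  interpret PP: product_prob_space D UNIV
    by (rule product_prob_spaceI) (rule prD)
  define M where "M = PiM UNIV D"
  interpret M: prob_space M unfolding M_def by (rule PP.P.prob_space_axioms)
  have spM: "\<omega> i \<in> carrier G" if "\<omega> \<in> space M" for \<omega> i
    using that by (auto simp: M_def space_PiM spD PiE_iff)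
  define Z where "Z = rec_nat (\<lambda>\<omega>. \<omega> 0) (\<lambda>t f \<omega>. f \<omega> \<otimes> \<omega> (Suc t))"
  have Z0: "Z 0 \<omega> = \<omega> 0" and ZS: "Z (Suc t) \<omega> = Z t \<omega> \<otimes> \<omega> (Suc t)" for t \<omega>
    by (simp_all add: Z_def)
  have Zc: "Z t \<omega> \<in> carrier G" if "\<omega> \<in> space M" for t \<omega>
    by (induction t) (use spM[OF that] in \<open>auto simp: Z0 ZS\<close>)
  define d where "d = (\<lambda>x i. case i of 0 \<Rightarrow> x 0 | Suc j \<Rightarrow> inv (x j) \<otimes> x (Suc j))"
  have path: "(\<forall>i\<le>t. Z i \<omega> = x i) \<longleftrightarrow> (\<forall>i\<in>{..t}. \<omega> i \<in> {d x i})"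
    if "\<omega> \<in> space M" and x: "\<And>i. i \<le> t \<Longrightarrow> x i \<in> carrier G" for \<omega> t x
    using x
  proof (induction t)
    case 0
    then show ?case by (simp add: Z0 d_def)
  next
    case (Suc t)
    have step: "Z (Suc t) \<omega> = x (Suc t) \<longleftrightarrow> \<omega> (Suc t) = d x (Suc t)" if "Z t \<omega> = x t"
    proof -
      have "Z (Suc t) \<omega> = x t \<otimes> \<omega> (Suc t)"
        using that by (simp only: ZS)
      moreover have "\<omega> (Suc t) = inv (x t) \<otimes> x (Suc t) \<longleftrightarrow> x (Suc t) = x t \<otimes> \<omega> (Suc t)"
        by (rule inv_solve_left) (use spM[OF \<open>\<omega> \<in> space M\<close>] Suc.prems in simp_all)
      moreover have "d x (Suc t) = inv (x t) \<otimes> x (Suc t)"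
        by (simp add: d_def)
      ultimately show ?thesis
        by metis
    qed
    have IH: "(\<forall>i\<le>t. Z i \<omega> = x i) \<longleftrightarrow> (\<forall>i\<in>{..t}. \<omega> i \<in> {d x i})"
      using Suc by simp
    have "(\<forall>i\<le>Suc t. Z i \<omega> = x i) \<longleftrightarrow> (\<forall>i\<le>t. Z i \<omega> = x i) \<and> Z (Suc t) \<omega> = x (Suc t)"
      by (metis le_Suc_eq)
    also have "\<dots> \<longleftrightarrow> (\<forall>i\<le>t. Z i \<omega> = x i) \<and> \<omega> (Suc t) = d x (Suc t)"
      using step by blast
    also have "\<dots> \<longleftrightarrow> (\<forall>i\<in>{..Suc t}. \<omega> i \<in> {d x i})"
      unfolding IH by (metis atMost_iff le_Suc_eq singletonD singletonI)
    finally show ?case .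
  qed
  have dc: "d x i \<in> carrier G" if "\<And>i. i \<le> t \<Longrightarrow> x i \<in> carrier G" "i \<le> t" for x i t
    using that by (auto simp: d_def split: nat.split)
  have prob: "\<P>(\<omega> in M. \<forall>i\<le>t. Z i \<omega> = x i) = (\<Prod>i\<le>t. p i (d x i))"
    if x: "\<And>i. i \<le> t \<Longrightarrow> x i \<in> carrier G" for t x
  proof -
    have dx: "d x i \<in> carrier G" if "i \<in> {..t}" for i
      by (rule dc[of t x]) (use x that in simp_all)
    have "(\<forall>i\<le>t. Z i \<omega> = x i) \<longleftrightarrow> (\<forall>i\<in>{..t}. \<omega> i \<in> {d x i})" if "\<omega> \<in> space M" for \<omega>
      by (rule path[OF that x])
    then have "{\<omega>\<in>space M. \<forall>i\<le>t. Z i \<omega> = x i} = {\<omega>\<in>space M. \<forall>i\<in>{..t}. \<omega> i \<in> {d x i}}"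
      by (intro Collect_cong conj_cong refl)
    moreover have "emeasure M {\<omega>\<in>space M. \<forall>i\<in>{..t}. \<omega> i \<in> {d x i}}
        = (\<Prod>i\<in>{..t}. emeasure (D i) {d x i})"
      unfolding M_def by (rule PP.emeasure_PiM_Collect) (use dx in \<open>simp_all add: seD\<close>)
    ultimately have "emeasure M {\<omega>\<in>space M. \<forall>i\<le>t. Z i \<omega> = x i}
        = (\<Prod>i\<in>{..t}. emeasure (D i) {d x i})"
      by (simp only:)
    also have "\<dots> = (\<Prod>i\<le>t. ennreal (p i (d x i)))"
      by (rule prod.cong[OF refl]) (rule eD[OF dx])
    also have "\<dots> = ennreal (\<Prod>i\<le>t. p i (d x i))"
      by (rule prod_ennreal) (rule p0[OF dx])
    finally show ?thesis
      unfolding measure_def by (simp only: enn2real_ennreal[OF prod_nonneg[OF p0[OF dx]]])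
  qed
  have comp: "(\<lambda>\<omega>. \<omega> i) \<in> measurable M (count_space (carrier G))" for i
  proof -
    have "(\<lambda>\<omega>. \<omega> i) \<in> measurable M (D i)"
      unfolding M_def by (rule measurable_component_singleton) simp
    also have "measurable M (D i) = measurable M (count_space (carrier G))"
      by (rule measurable_cong_sets) (auto simp: seD)
    finally show ?thesis .
  qed
  have Zm: "Z t \<in> measurable M (count_space (carrier G))" for t
  proof (induction t)
    case 0
    then show ?case using comp[of 0] by (simp add: Z_def)
  next
    case (Suc t)
    have "(\<lambda>\<omega>. (Z t \<omega>, \<omega> (Suc t)))
        \<in> measurable M (count_space (carrier G) \<Otimes>\<^sub>M count_space (carrier G))"
      using Suc comp by (rule measurable_Pair)
    then have *: "(\<lambda>\<omega>. (Z t \<omega>, \<omega> (Suc t))) \<in> measurable M (count_space (carrier G \<times> carrier G))"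
      by (simp add: pair_measure_count_space fin)
    have "(\<lambda>\<omega>. (\<lambda>(a, b). a \<otimes> b) (Z t \<omega>, \<omega> (Suc t))) \<in> measurable M (count_space (carrier G))"
      by (rule measurable_compose[OF *]) auto
    then show ?case by (simp add: ZS[abs_def] Z_def)
  qed
  have "is_MC G \<alpha> w M Z"
    unfolding is_MC_def W_def[symmetric]
  proof (intro conjI ballI)
    show "homogeneous_markov_chain M (carrier G) (\<lambda>x y. w (inv x \<otimes> y) / W) Z"
    proof unfold_locales
      fix x assume x: "x \<in> carrier G"
      have "(\<Sum>y\<in>carrier G. w (inv x \<otimes> y)) = W"
        unfolding W_def by (rule sum_l_translate) (use fin x in auto)
      then show "(\<Sum>y\<in>carrier G. w (inv x \<otimes> y) / W) = 1"
        using W by (simp flip: sum_divide_distrib)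
    next
      fix t h y assume pos: "0 < \<P>(\<omega> in M. \<forall>i\<le>t. Z i \<omega> = h i)" and y: "y \<in> carrier G"
      have h: "h i \<in> carrier G" if "i \<le> t" for i
      proof (rule ccontr)
        assume "h i \<notin> carrier G"
        then have "{\<omega> \<in> space M. \<forall>i\<le>t. Z i \<omega> = h i} = {}"
          using that Zc[of _ i] by (metis (mono_tags, lifting) Collect_empty_eq)
        with pos show False by simp
      qed
      define h' where "h' = h(Suc t := y)"
      have h': "h' i \<in> carrier G" if "i \<le> Suc t" for i
        using that h y by (auto simp: h'_def le_Suc_eq)
      have ev: "{\<omega>\<in>space M. Z (Suc t) \<omega> = y \<and> (\<forall>i\<le>t. Z i \<omega> = h i)}
          = {\<omega>\<in>space M. \<forall>i\<le>Suc t. Z i \<omega> = h' i}"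
        by (auto simp: h'_def le_Suc_eq)
      have split: "(\<Prod>i\<le>Suc t. p i (d h' i)) = (\<Prod>i\<le>t. p i (d h i)) * (w (inv (h t) \<otimes> y) / W)"
      proof -
        have "(\<Prod>i\<le>t. p i (d h' i)) = (\<Prod>i\<le>t. p i (d h i))"
          by (rule prod.cong) (auto simp: h'_def d_def split: nat.split)
        moreover have "p (Suc t) (d h' (Suc t)) = w (inv (h t) \<otimes> y) / W"
          by (simp add: p_def d_def h'_def)
        ultimately show ?thesis by simp
      qed
      have ph: "\<P>(\<omega> in M. \<forall>i\<le>t. Z i \<omega> = h i) = (\<Prod>i\<le>t. p i (d h i))"
        by (rule prob) (rule h)
      have ph': "\<P>(\<omega> in M. \<forall>i\<le>Suc t. Z i \<omega> = h' i) = (\<Prod>i\<le>Suc t. p i (d h' i))"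
        by (rule prob) (rule h')
      show "\<P>(\<omega> in M. Z (Suc t) \<omega> = y \<bar> \<forall>i\<le>t. Z i \<omega> = h i) = w (inv (h t) \<otimes> y) / W"
        unfolding cond_prob_def ev ph' split ph
        by (rule nonzero_mult_div_cancel_left) (use pos ph in linarith)
    qed (use fin Zm w0 W in auto)
  next
    fix x assume "x \<in> carrier G"
    then show "\<P>(\<omega> in M. Z 0 \<omega> = x) = \<alpha> x"
      using prob[of 0 "\<lambda>_. x"] by (simp add: d_def p_def)
  qed
  then show ?thesis by blast
qed

end

theory Submission
  imports Defs "HOL-Algebra.Multiplicative_Group"
begin

text \<open>
  Write \<open>x\<close> for an element of the group algebra and call the sums of \<open>x\<close> over the left cosets of \<open>H\<close>
  its coset masses. Restricting \<open>x\<close> to a coset \<open>C\<close> and multiplying by \<open>w\<close> on the right is, for a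
  subprobability distribution and up to normalisation, conditioning the walk on being in \<open>C\<close> and
  taking one step. Iterating this from \<open>\<alpha>\<close> along a list of cosets gives the law of the walk on
  the event that its first positions lie in these cosets (\<open>observe_eq_path_probability\<close>). Hence the
  lumped chain is Markov with matrix \<open>Q\<close> exactly when all these vectors satisfy one and the same
  system of linear equations: the mass that flows from \<open>C\<close> to \<open>D\<close> is the mass in \<open>C\<close> times
  \<open>w(G) Q(C, D)\<close>. Call such vectors balanced for \<open>q = w(G) Q\<close>, and stably balanced if they
  stay balanced under all further observations. So \<open>\<alpha>\<close> lumps weakly with matrix \<open>Q\<close> if and only if
  \<open>\<alpha>\<close> is stably balanced (\<open>lumped_chain_iff\<close>).

  The stably balanced vectors form a linear subspace closed under right multiplication by \<open>w\<close>,
  under restriction to cosets and under limits. Since \<open>w\<close> is irreducible, such a subspace is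
  preserved by a strictly positive element, whose powers push every vector of mass 1 to the uniform
  distribution, so \<open>\<eta>\<^sub>G\<close> lies in each such
  subspace that meets the vectors of mass 1 (\<open>uniform_distribution_in_closed_subspace\<close>). Being
  balanced, \<open>\<eta>\<^sub>G\<close> determines \<open>q\<close>: it has to be the average flow \<open>mean_jump\<close>, whatever \<open>\<alpha>\<close> is. This
  average is invariant under left translation by \<open>G\<close>, so the stably balanced vectors for it are a left
  ideal, in fact a Gurvits-Ledoux ideal, and therefore contain \<open>L\<^bsub>\<alpha>,w\<^esub>\<close> as soon as they contain
  \<open>\<alpha>\<close>. Conversely \<open>L\<^bsub>\<alpha>,w\<^esub>\<close> contains all observations of \<open>\<alpha>\<close>. So weak lumping means that every
  element of \<open>L\<^bsub>\<alpha>,w\<^esub>\<close> is balanced for the average flow (\<open>lumps_weakly_iff\<close>).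

  It remains to read this off the inclusion of ideals. A Gurvits-Ledoux ideal \<open>L\<close> contains a multiple
  of \<open>\<eta>\<^sub>H\<close>, namely the projection of \<open>\<eta>\<^sub>G\<close>, so \<open>L (1 - \<eta>\<^sub>H)\<close> consists of the elements of
  \<open>L\<close> whose coset masses all vanish. For \<open>x \<in> L\<close> the mass of \<open>x (1 - \<eta>\<^sub>H) w\<close> in \<open>D\<close> is the
  defect of the balance equations of \<open>x\<close> for the average flow, summed over \<open>C\<close>; restricting \<open>x\<close> to
  a single coset isolates each summand (\<open>ideal_condition_iff_balanced\<close>).
\<close>

section \<open>Subspaces of the group algebra\<close>

lemma group_algebra_mult:
  "(f \<otimes>\<^bsub>group_algebra G\<^esub> g) x =
    (if x \<in> carrier G then \<Sum>y\<in>carrier G. f y * g (inv\<^bsub>G\<^esub> y \<otimes>\<^bsub>G\<^esub> x) else 0)"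
  by (simp add: group_algebra_def)

lemma group_algebra_carrier:
  "x \<in> carrier (group_algebra G) \<longleftrightarrow> (\<forall>g. g \<notin> carrier G \<longrightarrow> x g = 0)"
  by (simp add: group_algebra_def)

lemma algebra_elem_carrier: "algebra_elem G r \<in> carrier (group_algebra G)"
  by (simp add: group_algebra_carrier algebra_elem_def)

lemma eta_carrier: "K \<subseteq> carrier G \<Longrightarrow> eta K \<in> carrier (group_algebra G)"
  by (auto simp: group_algebra_carrier eta_def)

definition linear_closed :: "('a \<Rightarrow> complex) set \<Rightarrow> bool"
  where "linear_closed N \<longleftrightarrow> (\<lambda>g. 0) \<in> N \<and>
    (\<forall>x\<in>N. \<forall>y\<in>N. \<forall>c d. (\<lambda>g. c * x g + d * y g) \<in> N)"

lemma linear_closedD: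
  "linear_closed N \<Longrightarrow> x \<in> N \<Longrightarrow> y \<in> N \<Longrightarrow> (\<lambda>g. c * x g + d * y g) \<in> N"
  by (simp add: linear_closed_def)

lemma linear_closed_sum:
  assumes "linear_closed N" "finite I" "\<And>i. i \<in> I \<Longrightarrow> f i \<in> N"
  shows "(\<lambda>g. \<Sum>i\<in>I. c i * f i g) \<in> N"
  using assms(2,3)
proof (induction I)
  case empty
  then show ?case using assms(1) by (simp add: linear_closed_def)
next
  case (insert i I)
  then have "(\<lambda>g. c i * f i g + 1 * (\<Sum>i\<in>I. c i * f i g)) \<in> N"
    by (intro linear_closedD[OF assms(1)]) auto
  then show ?case using insert by simp
qed

definition pointwise_closed :: "('a \<Rightarrow> complex) set \<Rightarrow> bool"
  where "pointwise_closed N \<longleftrightarrow>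
    (\<forall>X x. (\<forall>n::nat. X n \<in> N) \<longrightarrow> (\<forall>g. (\<lambda>n. X n g) \<longlonglongrightarrow> x g) \<longrightarrow> x \<in> N)"

section \<open>Irreducible weights mix to the uniform distribution\<close>

context group
begin

lemma sum_inv_translate:
  assumes "finite (carrier G)" "a \<in> carrier G"
  shows "(\<Sum>y\<in>carrier G. F (inv a \<otimes> y)) = (\<Sum>y\<in>carrier G. F y)"
  using sum_l_translate[of "inv a" F] assms by simp

lemma sum_group_algebra_mult:
  assumes fin: "finite (carrier G)"
  shows "(\<Sum>y\<in>carrier G. (x \<otimes>\<^bsub>group_algebra G\<^esub> p) y) =
    (\<Sum>y\<in>carrier G. x y) * (\<Sum>y\<in>carrier G. p y)"
proof -
  have "(\<Sum>y\<in>carrier G. (x \<otimes>\<^bsub>group_algebra G\<^esub> p) y)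
      = (\<Sum>a\<in>carrier G. \<Sum>y\<in>carrier G. x a * p (inv a \<otimes> y))"
    unfolding group_algebra_mult by (simp cong: sum.cong) (rule sum.swap)
  also have "\<dots> = (\<Sum>a\<in>carrier G. x a * (\<Sum>y\<in>carrier G. p y))"
    by (simp add: sum_inv_translate[OF fin] flip: sum_distrib_left)
  finally show ?thesis by (simp add: sum_distrib_right)
qed

lemma finite_submonoid_inv_closed:
  assumes fin: "finite (carrier G)" and S: "S \<subseteq> carrier G"
    and one: "\<one> \<in> S" and mult: "\<And>g h. g \<in> S \<Longrightarrow> h \<in> S \<Longrightarrow> g \<otimes> h \<in> S"
    and h: "h \<in> S"
  shows "inv h \<in> S"
proof -
  have pow: "h [^] (n::nat) \<in> S" for n
    by (induction n) (use one mult h in auto)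
  have hG: "h \<in> carrier G" using S h by auto
  have "Coset.order G > 0" using fin order_gt_0_iff_finite by blast
  then obtain n where n: "Coset.order G = Suc n"
    using gr0_implies_Suc by blast
  have "h [^] n \<otimes> h = \<one>"
    using pow_order_eq_1[OF hG] by (simp add: n)
  then have "inv h = h [^] n"
    by (rule inv_equality) (use hG in auto)
  then show ?thesis using pow by simp
qed

text \<open>Subtracting the constant \<open>m\<close> from \<open>p\<close> does not change the product with an element of total
  mass \<open>0\<close>, and it leaves nonnegative coefficients of total mass \<open>1 - |G| m\<close>.\<close>

lemma l1_norm_contraction:
  fixes p :: "'a \<Rightarrow> real" and m :: real
  assumes fin: "finite (carrier G)" and m: "\<And>g. g \<in> carrier G \<Longrightarrow> m \<le> p g"
    and p1: "(\<Sum>g\<in>carrier G. p g) = 1" and e0: "(\<Sum>g\<in>carrier G. e g) = 0"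
  shows "(\<Sum>y\<in>carrier G. cmod ((e \<otimes>\<^bsub>group_algebra G\<^esub> algebra_elem G p) y))
    \<le> (1 - card (carrier G) * m) * (\<Sum>g\<in>carrier G. cmod (e g))"
proof -
  have "cmod ((e \<otimes>\<^bsub>group_algebra G\<^esub> algebra_elem G p) y)
      \<le> (\<Sum>a\<in>carrier G. cmod (e a) * (p (inv a \<otimes> y) - m))" if y: "y \<in> carrier G" for y
  proof -
    have "(e \<otimes>\<^bsub>group_algebra G\<^esub> algebra_elem G p) y
        = (\<Sum>a\<in>carrier G. e a * of_real (p (inv a \<otimes> y)))"
      using y by (simp add: group_algebra_mult algebra_elem_def)
    also have "\<dots> = (\<Sum>a\<in>carrier G. e a * of_real (p (inv a \<otimes> y))) - (\<Sum>a\<in>carrier G. e a) * of_real m"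
      by (simp add: e0)
    also have "\<dots> = (\<Sum>a\<in>carrier G. e a * of_real (p (inv a \<otimes> y) - m))"
      by (simp add: sum_distrib_right sum_subtractf right_diff_distrib)
    finally have "cmod ((e \<otimes>\<^bsub>group_algebra G\<^esub> algebra_elem G p) y)
        \<le> (\<Sum>a\<in>carrier G. cmod (e a * of_real (p (inv a \<otimes> y) - m)))"
      by (simp only: norm_sum)
    also have "\<dots> = (\<Sum>a\<in>carrier G. cmod (e a) * (p (inv a \<otimes> y) - m))"
      by (intro sum.cong refl) (use m y in \<open>simp only: norm_mult norm_of_real, simp\<close>)
    finally show ?thesis .
  qed
  then have "(\<Sum>y\<in>carrier G. cmod ((e \<otimes>\<^bsub>group_algebra G\<^esub> algebra_elem G p) y))
      \<le> (\<Sum>y\<in>carrier G. \<Sum>a\<in>carrier G. cmod (e a) * (p (inv a \<otimes> y) - m))"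
    by (rule sum_mono)
  also have "\<dots> = (\<Sum>a\<in>carrier G. cmod (e a) * (\<Sum>y\<in>carrier G. p (inv a \<otimes> y) - m))"
    by (subst sum.swap) (simp add: sum_distrib_left)
  also have "\<dots> = (\<Sum>a\<in>carrier G. cmod (e a) * (1 - card (carrier G) * m))"
    by (intro sum.cong refl) (simp add: sum_subtractf sum_inv_translate[OF fin] p1)
  also have "\<dots> = (1 - card (carrier G) * m) * (\<Sum>g\<in>carrier G. cmod (e g))"
    by (subst sum_distrib_right[symmetric]) (rule mult.commute)
  finally show ?thesis .
qed

text \<open>The right multipliers of \<open>N\<close> form an algebra. The elements of \<open>G\<close> charged by some nonnegative
  multiplier form a submonoid that contains the support of \<open>w\<close>; a submonoid of a finite group is a
  subgroup, so by irreducibility every element is charged, and a sum of multipliers charges all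
  elements at once. Unlike the powers of \<open>w\<close> themselves, such a \<open>p\<close> has no periodicity.\<close>

lemma strictly_positive_multiplier:
  assumes fin: "finite (carrier G)" and w: "irreducible_weight G w"
    and NA: "N \<subseteq> carrier (group_algebra G)" and lin: "linear_closed N"
    and Nw: "\<And>x. x \<in> N \<Longrightarrow> x \<otimes>\<^bsub>group_algebra G\<^esub> algebra_elem G w \<in> N"
  obtains p :: "'a \<Rightarrow> real" where "\<And>g. g \<in> carrier G \<Longrightarrow> 0 < p g" "(\<Sum>g\<in>carrier G. p g) = 1"
    "\<And>x. x \<in> N \<Longrightarrow> x \<otimes>\<^bsub>group_algebra G\<^esub> algebra_elem G p \<in> N"
proof -
  interpret A: ring "group_algebra G" by (rule ring_group_algebra[OF fin])
  define R where "R = {r :: 'a \<Rightarrow> real. (\<forall>g\<in>carrier G. 0 \<le> r g) \<and>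
    (\<forall>x\<in>N. x \<otimes>\<^bsub>group_algebra G\<^esub> algebra_elem G r \<in> N)}"
  define S where "S = {g \<in> carrier G. \<exists>r\<in>R. 0 < r g}"
  have one: "\<one> \<in> S"
  proof -
    have "algebra_elem G (\<lambda>g. if g = \<one> then 1 else 0) = \<one>\<^bsub>group_algebra G\<^esub>"
      by (auto simp: algebra_elem_def group_algebra_def)
    then have "(\<lambda>g. if g = \<one> then 1 else 0) \<in> R"
      using NA by (auto simp: R_def subset_iff)
    then show ?thesis by (auto simp: S_def intro!: bexI[of _ "\<lambda>g. if g = \<one> then 1 else 0"])
  qed
  have mult: "g \<otimes> h \<in> S" if g: "g \<in> S" and h: "h \<in> S" for g h
  proof -
    obtain r s where r: "r \<in> R" "0 < r g" and s: "s \<in> R" "0 < s h"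
      using g h by (auto simp: S_def)
    have gh: "g \<in> carrier G" "h \<in> carrier G" using g h by (auto simp: S_def)
    define q where "q = (\<lambda>y. \<Sum>a\<in>carrier G. r a * s (inv a \<otimes> y))"
    have "algebra_elem G r \<otimes>\<^bsub>group_algebra G\<^esub> algebra_elem G s = algebra_elem G q"
      by (auto simp: fun_eq_iff group_algebra_mult algebra_elem_def q_def)
    have "x \<otimes>\<^bsub>group_algebra G\<^esub> algebra_elem G q \<in> N" if "x \<in> N" for x
    proof -
      have "(x \<otimes>\<^bsub>group_algebra G\<^esub> algebra_elem G r) \<otimes>\<^bsub>group_algebra G\<^esub> algebra_elem G s \<in> N"
        using that r s by (auto simp: R_def)
      moreover have "x \<in> carrier (group_algebra G)" using that NA by auto
      ultimately show ?thesis
        using \<open>algebra_elem G r \<otimes>\<^bsub>group_algebra G\<^esub> algebra_elem G s = algebra_elem G q\<close>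
        by (simp add: A.m_assoc algebra_elem_carrier)
    qed
    moreover have nn: "0 \<le> r a * s (inv a \<otimes> y)" if "a \<in> carrier G" "y \<in> carrier G" for a y
      using that r s by (auto simp: R_def)
    ultimately have "q \<in> R"
      by (auto simp: R_def q_def intro!: sum_nonneg)
    moreover have "0 < q (g \<otimes> h)"
    proof -
      have "0 < r g * s (inv g \<otimes> (g \<otimes> h))"
        using r s gh by (simp flip: m_assoc)
      then show ?thesis
        unfolding q_def using fin gh nn by (intro sum_pos2[of _ g]) auto
    qed
    ultimately show ?thesis using gh by (auto simp: S_def)
  qed
  have supp: "h \<in> S" if "h \<in> carrier G" "w h \<noteq> 0" for h
  proof -
    have "w \<in> R" using w Nw by (auto simp: R_def irreducible_weight_def weight_def)
    moreover have "0 < w h" using that w by (simp add: less_le irreducible_weight_def weight_def)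
    ultimately show ?thesis using that by (auto simp: S_def)
  qed
  have inv: "inv h \<in> S" if "h \<in> S" for h
    by (rule finite_submonoid_inv_closed[OF fin _ one mult that]) (auto simp: S_def)
  have "g \<in> S" if "g \<in> generate G {g \<in> carrier G. w g \<noteq> 0}" for g
    using that by (induction rule: generate.induct) (auto intro: one mult supp inv)
  then have "\<forall>g\<in>carrier G. \<exists>r\<in>R. 0 < r g"
    using w by (auto simp: irreducible_weight_def S_def)
  then obtain r where r: "\<And>g. g \<in> carrier G \<Longrightarrow> r g \<in> R" "\<And>g. g \<in> carrier G \<Longrightarrow> 0 < r g g"
    by metis
  define s where "s = (\<lambda>y. \<Sum>g\<in>carrier G. r g y)"
  have s: "0 < s y" if "y \<in> carrier G" for y
    unfolding s_def by (rule sum_pos2[of _ y]) (use fin that r in \<open>auto simp: R_def\<close>)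
  define T where "T = (\<Sum>y\<in>carrier G. s y)"
  have T: "0 < T"
    unfolding T_def by (rule sum_pos) (use fin s in auto)
  show thesis
  proof (rule that[of "\<lambda>g. s g / T"])
    show "(\<Sum>g\<in>carrier G. s g / T) = 1"
      using T by (simp add: T_def flip: sum_divide_distrib)
    fix x assume x: "x \<in> N"
    have "x \<otimes>\<^bsub>group_algebra G\<^esub> algebra_elem G (\<lambda>g. s g / T)
        = (\<lambda>y. \<Sum>g\<in>carrier G. (1 / of_real T) * (x \<otimes>\<^bsub>group_algebra G\<^esub> algebra_elem G (r g)) y)"
    proof
      fix y
      show "(x \<otimes>\<^bsub>group_algebra G\<^esub> algebra_elem G (\<lambda>g. s g / T)) y
        = (\<Sum>g\<in>carrier G. (1 / of_real T) * (x \<otimes>\<^bsub>group_algebra G\<^esub> algebra_elem G (r g)) y)"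
        by (auto simp: group_algebra_mult algebra_elem_def s_def sum_distrib_left
            sum_divide_distrib intro: sum.swap)
    qed
    also have "\<dots> \<in> N"
      by (rule linear_closed_sum[OF lin fin]) (use r x in \<open>auto simp: R_def\<close>)
    finally show "x \<otimes>\<^bsub>group_algebra G\<^esub> algebra_elem G (\<lambda>g. s g / T) \<in> N" .
  qed (use s T in auto)
qed

text \<open>Multiplying repeatedly by a strictly positive \<open>p\<close> contracts the difference to \<open>\<eta>\<^sub>G\<close>: this
  difference has total mass \<open>0\<close>, and multiplying it by \<open>p\<close> gives the next difference because
  \<open>\<eta>\<^sub>G p = \<eta>\<^sub>G\<close>.\<close>

lemma uniform_distribution_in_closed_subspace:
  assumes fin: "finite (carrier G)" and w: "irreducible_weight G w"
    and NA: "N \<subseteq> carrier (group_algebra G)" and lin: "linear_closed N"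
    and Nw: "\<And>x. x \<in> N \<Longrightarrow> x \<otimes>\<^bsub>group_algebra G\<^esub> algebra_elem G w \<in> N"
    and closed: "pointwise_closed N"
    and x: "x \<in> N" and x1: "(\<Sum>g\<in>carrier G. x g) = 1"
  shows "eta (carrier G) \<in> N"
proof -
  obtain p :: "'a \<Rightarrow> real" where p: "\<And>g. g \<in> carrier G \<Longrightarrow> 0 < p g" "(\<Sum>g\<in>carrier G. p g) = 1"
    and Np: "\<And>x. x \<in> N \<Longrightarrow> x \<otimes>\<^bsub>group_algebra G\<^esub> algebra_elem G p \<in> N"
    using strictly_positive_multiplier[OF fin w NA lin Nw] by metis
  interpret A: ring "group_algebra G" by (rule ring_group_algebra[OF fin])
  define P where "P = algebra_elem G p"
  have PA: "P \<in> carrier (group_algebra G)" by (simp add: P_def algebra_elem_carrier)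
  define \<eta> where "\<eta> = eta (carrier G)"
  have ne: "carrier G \<noteq> {}" by auto
  then have card: "card (carrier G) > 0" using fin by (simp add: card_gt_0_iff)
  define m where "m = Min (p ` carrier G)"
  have m: "m \<le> p g" if "g \<in> carrier G" for g using that fin by (simp add: m_def)
  have m0: "0 < m" using fin ne p(1) by (simp add: m_def)
  define \<rho> where "\<rho> = 1 - card (carrier G) * m"
  have \<rho>1: "\<rho> < 1" using m0 card by (simp add: \<rho>_def)
  have \<rho>0: "0 \<le> \<rho>"
    using sum_mono[of "carrier G" "\<lambda>_. m" p] m p(2) by (simp add: \<rho>_def)
  have P1: "(\<Sum>g\<in>carrier G. P g) = 1"
    using p(2) by (simp add: P_def algebra_elem_def flip: of_real_sum)
  have \<eta>P: "\<eta> \<otimes>\<^bsub>group_algebra G\<^esub> P = \<eta>"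
  proof
    fix y
    show "(\<eta> \<otimes>\<^bsub>group_algebra G\<^esub> P) y = \<eta> y"
    proof (cases "y \<in> carrier G")
      case True
      have "(\<Sum>a\<in>carrier G. P (inv a \<otimes> y)) = (\<Sum>a\<in>carrier G. P a)"
        by (rule sum.reindex_bij_witness[where j="\<lambda>a. inv a \<otimes> y" and i="\<lambda>a. y \<otimes> inv a"])
          (use True in \<open>auto simp: inv_mult_group m_assoc simp flip: m_assoc[of y "inv y"]\<close>)
      then show ?thesis
        using True P1
        by (simp add: group_algebra_mult \<eta>_def eta_def flip: sum_divide_distrib)
    qed (simp add: group_algebra_mult \<eta>_def eta_def)
  qed
  define X where "X = (\<lambda>n. ((\<lambda>z. z \<otimes>\<^bsub>group_algebra G\<^esub> P) ^^ n) x)"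
  have X0: "X 0 = x" and XS: "X (Suc n) = X n \<otimes>\<^bsub>group_algebra G\<^esub> P" for n
    by (simp_all add: X_def)
  have XN: "X n \<in> N" for n
    by (induction n) (use x Np in \<open>auto simp: X0 XS P_def\<close>)
  have X1: "(\<Sum>g\<in>carrier G. X n g) = 1" for n
    by (induction n) (simp_all add: X0 XS x1 sum_group_algebra_mult[OF fin] P1)
  define e where "e = (\<lambda>n g. X n g - \<eta> g)"
  have eS: "e (Suc n) = e n \<otimes>\<^bsub>group_algebra G\<^esub> P" for n
  proof
    fix y
    have "(X n \<otimes>\<^bsub>group_algebra G\<^esub> P) y - (\<eta> \<otimes>\<^bsub>group_algebra G\<^esub> P) y
        = (e n \<otimes>\<^bsub>group_algebra G\<^esub> P) y"
      by (simp add: group_algebra_mult e_def left_diff_distrib sum_subtractf)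
    then show "e (Suc n) y = (e n \<otimes>\<^bsub>group_algebra G\<^esub> P) y"
      by (simp add: \<eta>P e_def XS)
  qed
  have e0: "(\<Sum>g\<in>carrier G. e n g) = 0" for n
    using card by (simp add: e_def sum_subtractf X1 \<eta>_def eta_def)
  define c where "c = (\<Sum>g\<in>carrier G. cmod (e 0 g))"
  have bound: "(\<Sum>g\<in>carrier G. cmod (e n g)) \<le> \<rho> ^ n * c" for n
  proof (induction n)
    case (Suc n)
    have "(\<Sum>g\<in>carrier G. cmod (e (Suc n) g)) \<le> \<rho> * (\<Sum>g\<in>carrier G. cmod (e n g))"
      unfolding eS P_def \<rho>_def by (rule l1_norm_contraction[OF fin m p(2) e0])
    also have "\<dots> \<le> \<rho> * (\<rho> ^ n * c)"
      using Suc \<rho>0 by (rule mult_left_mono)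
    finally show ?case by (simp add: mult.assoc)
  qed (simp add: c_def)
  have "(\<lambda>n. X n g) \<longlonglongrightarrow> \<eta> g" for g
  proof (cases "g \<in> carrier G")
    case True
    have "norm (e n g) \<le> \<rho> ^ n * c" for n
      using member_le_sum[of g "carrier G" "\<lambda>g. cmod (e n g)"] True fin bound[of n] by auto
    moreover have "(\<lambda>n. \<rho> ^ n * c) \<longlonglongrightarrow> 0"
      using \<rho>0 \<rho>1 by (intro tendsto_mult_left_zero LIMSEQ_power_zero) auto
    ultimately have "(\<lambda>n. e n g) \<longlonglongrightarrow> 0"
      by (intro Lim_null_comparison[of "\<lambda>n. e n g" "\<lambda>n. \<rho> ^ n * c"]) auto
    then show ?thesis by (simp add: e_def LIM_zero_iff)
  next
    case False
    then have "X n g = \<eta> g" for n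
      using XN[of n] NA by (auto simp: group_algebra_carrier subset_iff \<eta>_def eta_def)
    then show ?thesis by simp
  qed
  then show ?thesis
    using closed XN unfolding pointwise_closed_def \<eta>_def[symmetric] by metis
qed

end

section \<open>Watching the walk through the cosets\<close>

locale coset_walk = group G for G :: "('a, 'b) monoid_scheme" (structure) +
  fixes H :: "'a set" and w :: "'a \<Rightarrow> real"
  assumes subgroup_H: "subgroup H G" and finite_carrier: "finite (carrier G)"
begin

lemma coset_subset: "C \<in> lcosets H \<Longrightarrow> C \<subseteq> carrier G"
  using subgroup.lcosets_carrier[OF subgroup_H] by (simp add: is_group)

lemma finite_coset: "C \<in> lcosets H \<Longrightarrow> finite C"
  using coset_subset finite_carrier finite_subset by blast

lemma finite_cosets: "finite (lcosets H)"
  using finite_carrier by (simp add: LCOSETS_def)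

lemma card_coset: "C \<in> lcosets H \<Longrightarrow> card C = card H"
  using l_card_cosets_equal[OF _ subgroup.subset[OF subgroup_H] finite_carrier] by simp

lemma card_H_pos: "card H > 0"
  using subgroup_H finite_carrier
  by (metis card_gt_0_iff finite_subset subgroup.one_closed subgroup.subset empty_iff)

lemma l_coset_in_cosets: "a \<in> carrier G \<Longrightarrow> a <# H \<in> lcosets H"
  by (auto simp: LCOSETS_def)

lemma coset_eq:
  assumes "a \<in> C" "C \<in> lcosets H"
  shows "C = a <# H"
proof -
  have "a \<in> carrier G" using assms coset_subset by auto
  then show ?thesis
    using assms lcos_disjoint[OF subgroup_H assms(2) l_coset_in_cosets, of a]
      lcos_self[OF _ subgroup_H, of a] by blast
qed

text \<open>For the walk, being at a point of \<open>C\<close> and having \<open>C\<close> as lumped state are the same event; the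
  algebra uses the first form, the lumped process the second.\<close>

lemma coset_mem_iff: "a \<in> carrier G \<Longrightarrow> C \<in> lcosets H \<Longrightarrow> a <# H = C \<longleftrightarrow> a \<in> C"
  using coset_eq lcos_self[OF _ subgroup_H] by metis

lemma sum_over_cosets:
  "(\<Sum>a\<in>carrier G. F a) = (\<Sum>C\<in>lcosets H. \<Sum>a\<in>C. F a)" for F :: "'a \<Rightarrow> 'c :: comm_monoid_add"
proof -
  have "(\<Sum>a\<in>\<Union>(lcosets H). F a) = (\<Sum>C\<in>lcosets H. \<Sum>a\<in>C. F a)"
    using lcos_disjoint[OF subgroup_H] finite_coset
    by (subst sum.Union_disjoint) auto
  then show ?thesis by (simp add: lcosets_part_G[OF subgroup_H])
qed

lemma translate_coset:
  assumes "g \<in> carrier G" "C \<in> lcosets H"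
  shows "g <# C \<in> lcosets H"
  using assms lcos_m_assoc[OF subgroup.subset[OF subgroup_H]] by (auto simp: LCOSETS_def)

lemma translate_inv_coset:
  assumes "g \<in> carrier G" "C \<in> lcosets H"
  shows "g <# (inv g <# C) = C"
  using assms coset_subset by (simp add: lcos_m_assoc lcos_mult_one)

lemma sum_translate_coset:
  assumes "g \<in> carrier G" "C \<subseteq> carrier G"
  shows "(\<Sum>a\<in>g <# C. F a) = (\<Sum>a\<in>C. F (g \<otimes> a))"
proof -
  have "g <# C = (\<lambda>a. g \<otimes> a) ` C" by (auto simp: l_coset_def)
  moreover have "inj_on (\<lambda>a. g \<otimes> a) C"
    using assms inj_on_cmult inj_on_subset by blast
  ultimately show ?thesis by (simp add: sum.reindex)
qed

lemma step_increment_translate: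
  assumes "g \<in> carrier G" "a \<in> carrier G" "y \<in> carrier G"
  shows "inv (g \<otimes> a) \<otimes> (g \<otimes> y) = inv a \<otimes> y"
proof -
  have "inv g \<otimes> (g \<otimes> y) = y" using assms by (simp flip: m_assoc)
  then show ?thesis using assms by (simp add: inv_mult_group m_assoc)
qed

text \<open>The weight is not normalised, so that the step multiplies the mass that \<open>x\<close> has in \<open>C\<close>
  by \<open>w(G)\<close>.\<close>

definition step :: "'a set \<Rightarrow> ('a \<Rightarrow> complex) \<Rightarrow> 'a \<Rightarrow> complex"
  where "step C x = subgroup_proj C x \<otimes>\<^bsub>group_algebra G\<^esub> algebra_elem G w"

definition observe :: "'a set list \<Rightarrow> ('a \<Rightarrow> complex) \<Rightarrow> 'a \<Rightarrow> complex"
  where "observe Cs x = foldl (\<lambda>x C. step C x) x Cs"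

lemma observe_Nil [simp]: "observe [] x = x"
  and observe_Cons [simp]: "observe (C # Cs) x = observe Cs (step C x)"
  and observe_snoc: "observe (Cs @ [C]) x = step C (observe Cs x)"
  by (simp_all add: observe_def)

definition jump :: "'a \<Rightarrow> 'a set \<Rightarrow> real"
  where "jump a D = (\<Sum>y\<in>D. w (inv a \<otimes> y))"

text \<open>The Markov property of the lumped chain at one fixed past, as linear equations in the
  vector \<open>x\<close> of weights that the past gives to the current position. A coset without mass imposes no
  condition on \<open>q\<close> if \<open>x\<close> is a subdistribution, matching the arbitrary rows of \<open>Q\<close> at states that
  are never visited.\<close>

definition balanced :: "('a set \<Rightarrow> 'a set \<Rightarrow> real) \<Rightarrow> ('a \<Rightarrow> complex) \<Rightarrow> bool"
  where "balanced q x \<longleftrightarrow> (\<forall>C\<in>lcosets H. \<forall>D\<in>lcosets H.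
    (\<Sum>a\<in>C. x a * of_real (jump a D)) = (\<Sum>a\<in>C. x a) * of_real (q C D))"

definition stably_balanced :: "('a set \<Rightarrow> 'a set \<Rightarrow> real) \<Rightarrow> ('a \<Rightarrow> complex) set"
  where "stably_balanced q = {x \<in> carrier (group_algebra G).
    \<forall>Cs\<in>lists (lcosets H). balanced q (observe Cs x)}"

text \<open>The flow from \<open>C\<close> to \<open>D\<close> out of the uniform distribution on \<open>C\<close>: all cosets have \<open>card H\<close>
  elements.\<close>

definition mean_jump :: "'a set \<Rightarrow> 'a set \<Rightarrow> real"
  where "mean_jump C D = (\<Sum>a\<in>C. jump a D) / card H"

text \<open>Left multiplication by the group element \<open>g\<close>.\<close>

definition translate :: "'a \<Rightarrow> ('a \<Rightarrow> complex) \<Rightarrow> 'a \<Rightarrow> complex"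
  where "translate g x = (\<lambda>y. if y \<in> carrier G then x (inv g \<otimes> y) else 0)"

lemma step_apply:
  assumes "C \<in> lcosets H"
  shows "step C x y = (if y \<in> carrier G then \<Sum>a\<in>C. x a * of_real (w (inv a \<otimes> y)) else 0)"
proof -
  have "(\<Sum>a\<in>carrier G. (if a \<in> C then x a else 0) * of_real (w (inv a \<otimes> y)))
      = (\<Sum>a\<in>C. x a * of_real (w (inv a \<otimes> y)))"
    by (rule sum.mono_neutral_cong_right)
      (use finite_carrier coset_subset[OF assms] in auto)
  moreover have "algebra_elem G w (inv a \<otimes> y) = of_real (w (inv a \<otimes> y))"
    if "a \<in> carrier G" "y \<in> carrier G" for a
    using that by (simp add: algebra_elem_def)
  ultimately show ?thesis
    by (simp add: step_def group_algebra_mult subgroup_proj_def)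
qed

lemma step_carrier: "step C x \<in> carrier (group_algebra G)"
  by (simp add: step_def group_algebra_carrier group_algebra_mult)

lemma sum_step:
  assumes "C \<in> lcosets H" "D \<in> lcosets H"
  shows "(\<Sum>y\<in>D. step C x y) = (\<Sum>a\<in>C. x a * of_real (jump a D))"
proof -
  have "(\<Sum>y\<in>D. step C x y) = (\<Sum>y\<in>D. \<Sum>a\<in>C. x a * of_real (w (inv a \<otimes> y)))"
    by (rule sum.cong) (use assms coset_subset in \<open>auto simp: step_apply\<close>)
  also have "\<dots> = (\<Sum>a\<in>C. \<Sum>y\<in>D. x a * of_real (w (inv a \<otimes> y)))"
    by (rule sum.swap)
  finally show ?thesis by (simp add: jump_def sum_distrib_left)
qed

lemma mult_weight_eq_sum_steps:
  assumes "x \<in> carrier (group_algebra G)"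
  shows "x \<otimes>\<^bsub>group_algebra G\<^esub> algebra_elem G w = (\<lambda>y. \<Sum>C\<in>lcosets H. 1 * step C x y)"
proof
  fix y
  show "(x \<otimes>\<^bsub>group_algebra G\<^esub> algebra_elem G w) y = (\<Sum>C\<in>lcosets H. 1 * step C x y)"
  proof (cases "y \<in> carrier G")
    case True
    have "(x \<otimes>\<^bsub>group_algebra G\<^esub> algebra_elem G w) y
        = (\<Sum>a\<in>carrier G. x a * of_real (w (inv a \<otimes> y)))"
      using True by (simp add: group_algebra_mult algebra_elem_def)
    also have "\<dots> = (\<Sum>C\<in>lcosets H. \<Sum>a\<in>C. x a * of_real (w (inv a \<otimes> y)))"
      by (rule sum_over_cosets)
    also have "\<dots> = (\<Sum>C\<in>lcosets H. 1 * step C x y)"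
      by (rule sum.cong) (use True in \<open>simp_all add: step_apply\<close>)
    finally show ?thesis .
  qed (simp add: step_apply group_algebra_mult)
qed

lemma left_mult_eq_sum_translates:
  "a \<otimes>\<^bsub>group_algebra G\<^esub> x = (\<lambda>y. \<Sum>g\<in>carrier G. a g * translate g x y)"
  by (auto simp: group_algebra_mult translate_def)

section \<open>Linearity and continuity of observations\<close>

lemma step_linear:
  "C \<in> lcosets H \<Longrightarrow>
    step C (\<lambda>g. c * x g + d * y g) = (\<lambda>g. c * step C x g + d * step C y g)"
  by (simp add: step_apply fun_eq_iff sum_distrib_left sum.distrib distrib_right mult.assoc)

lemma observe_linear:
  "Cs \<in> lists (lcosets H) \<Longrightarrow>
    observe Cs (\<lambda>g. c * x g + d * y g) = (\<lambda>g. c * observe Cs x g + d * observe Cs y g)"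
  by (induction Cs arbitrary: x y) (auto simp: step_linear)

lemma observe_zero: "Cs \<in> lists (lcosets H) \<Longrightarrow> observe Cs (\<lambda>g. 0) = (\<lambda>g. 0)"
  using observe_linear[of Cs 0 _ 0] by simp

lemma observe_tendsto:
  assumes "Cs \<in> lists (lcosets H)" "\<And>g. (\<lambda>n. X n g) \<longlonglongrightarrow> x g"
  shows "(\<lambda>n. observe Cs (X n) g) \<longlonglongrightarrow> observe Cs x g"
  using assms
proof (induction Cs arbitrary: X x)
  case (Cons C Cs)
  have C: "C \<in> lcosets H" using Cons.hyps by simp
  have "(\<lambda>n. step C (X n) g) \<longlonglongrightarrow> step C x g" for g
    using Cons.prems
    by (cases "g \<in> carrier G") (auto simp: step_apply[OF C] intro!: tendsto_intros)
  then show ?case by (simp add: Cons.IH)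
qed simp

lemma balanced_linear:
  assumes "balanced q x" "balanced q y"
  shows "balanced q (\<lambda>g. c * x g + d * y g)"
  unfolding balanced_def
proof (intro ballI)
  fix C D assume CD: "C \<in> lcosets H" "D \<in> lcosets H"
  have "(\<Sum>a\<in>C. (c * x a + d * y a) * of_real (jump a D))
      = c * (\<Sum>a\<in>C. x a * of_real (jump a D)) + d * (\<Sum>a\<in>C. y a * of_real (jump a D))"
    by (simp add: distrib_right sum.distrib sum_distrib_left mult.assoc)
  also have "\<dots> = c * ((\<Sum>a\<in>C. x a) * of_real (q C D)) + d * ((\<Sum>a\<in>C. y a) * of_real (q C D))"
    using assms CD by (simp add: balanced_def)
  also have "\<dots> = (\<Sum>a\<in>C. c * x a + d * y a) * of_real (q C D)"
    by (simp add: distrib_right sum.distrib mult.assoc flip: sum_distrib_left)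
  finally show "(\<Sum>a\<in>C. (c * x a + d * y a) * of_real (jump a D))
      = (\<Sum>a\<in>C. c * x a + d * y a) * of_real (q C D)" .
qed

lemma linear_closed_stably_balanced: "linear_closed (stably_balanced q)"
  by (auto simp: linear_closed_def stably_balanced_def observe_linear observe_zero
      group_algebra_carrier intro: balanced_linear) (auto simp: balanced_def)

lemma pointwise_closed_stably_balanced: "pointwise_closed (stably_balanced q)"
  unfolding pointwise_closed_def
proof (intro allI impI)
  fix X :: "nat \<Rightarrow> 'a \<Rightarrow> complex" and x
  assume X: "\<forall>n. X n \<in> stably_balanced q" and lim: "\<forall>g. (\<lambda>n. X n g) \<longlonglongrightarrow> x g"
  have "x g = 0" if "g \<notin> carrier G" for g
  proof -
    have "X n g = 0" for n using X that by (auto simp: stably_balanced_def group_algebra_carrier)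
    then show ?thesis using lim[rule_format, of g] by (simp add: LIMSEQ_const_iff)
  qed
  moreover have "balanced q (observe Cs x)" if Cs: "Cs \<in> lists (lcosets H)" for Cs
    unfolding balanced_def
  proof (intro ballI)
    fix C D assume CD: "C \<in> lcosets H" "D \<in> lcosets H"
    have obs: "(\<lambda>n. observe Cs (X n) g) \<longlonglongrightarrow> observe Cs x g" for g
      using Cs lim by (intro observe_tendsto) auto
    have "(\<lambda>n. \<Sum>a\<in>C. observe Cs (X n) a * of_real (jump a D))
        \<longlonglongrightarrow> (\<Sum>a\<in>C. observe Cs x a * of_real (jump a D))"
      by (intro tendsto_intros obs)
    moreover have "(\<lambda>n. (\<Sum>a\<in>C. observe Cs (X n) a) * of_real (q C D))
        \<longlonglongrightarrow> (\<Sum>a\<in>C. observe Cs x a) * of_real (q C D)"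
      by (intro tendsto_intros obs)
    moreover have "(\<Sum>a\<in>C. observe Cs (X n) a * of_real (jump a D))
        = (\<Sum>a\<in>C. observe Cs (X n) a) * of_real (q C D)" for n
      using X Cs CD by (auto simp: stably_balanced_def balanced_def)
    ultimately show "(\<Sum>a\<in>C. observe Cs x a * of_real (jump a D))
        = (\<Sum>a\<in>C. observe Cs x a) * of_real (q C D)"
      using LIMSEQ_unique by simp
  qed
  ultimately show "x \<in> stably_balanced q"
    by (simp add: stably_balanced_def group_algebra_carrier)
qed

section \<open>The space of stably balanced vectors\<close>

lemma stably_balancedD:
  "x \<in> stably_balanced q \<Longrightarrow> Cs \<in> lists (lcosets H) \<Longrightarrow> balanced q (observe Cs x)"
  by (simp add: stably_balanced_def)

lemma stably_balanced_step:
  assumes "x \<in> stably_balanced q" "C \<in> lcosets H"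
  shows "step C x \<in> stably_balanced q"
proof -
  have "balanced q (observe (C # Cs) x)" if "Cs \<in> lists (lcosets H)" for Cs
    using stably_balancedD[OF assms(1)] assms(2) that by (simp del: observe_Cons)
  then show ?thesis by (simp add: stably_balanced_def step_carrier)
qed

text \<open>Right multiplication by \<open>w\<close> without any observation is the sum, over all cosets, of the steps
  that observe that coset.\<close>

lemma stably_balanced_mult_weight:
  assumes "x \<in> stably_balanced q"
  shows "x \<otimes>\<^bsub>group_algebra G\<^esub> algebra_elem G w \<in> stably_balanced q"
proof -
  have "(\<lambda>y. \<Sum>C\<in>lcosets H. 1 * step C x y) \<in> stably_balanced q"
    by (rule linear_closed_sum[OF linear_closed_stably_balanced finite_cosets])
      (use assms in \<open>simp add: stably_balanced_step\<close>)
  then show ?thesis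
    using assms by (simp add: mult_weight_eq_sum_steps stably_balanced_def)
qed

lemma sum_subgroup_proj:
  assumes "C \<in> lcosets H" "D \<in> lcosets H"
  shows "(\<Sum>a\<in>C. subgroup_proj D x a * f a) = (if C = D then \<Sum>a\<in>C. x a * f a else 0)"
proof (cases "C = D")
  case False
  then have "C \<inter> D = {}" using lcos_disjoint[OF subgroup_H] assms by auto
  then have "subgroup_proj D x a = 0" if "a \<in> C" for a
    using that by (auto simp: subgroup_proj_def)
  then show ?thesis using False by simp
qed (simp add: subgroup_proj_def)

lemma step_subgroup_proj:
  assumes "C \<in> lcosets H" "D \<in> lcosets H"
  shows "step C (subgroup_proj D x) = (if C = D then step C x else (\<lambda>g. 0))"
proof (cases "C = D")
  case False
  then show ?thesis
    using assms by (simp add: step_apply sum_subgroup_proj fun_eq_iff)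
qed (simp add: step_def subgroup_proj_def cong: if_cong)

text \<open>Restricting to \<open>D\<close> amounts to observing \<open>D\<close> now: the first later observation either agrees
  with \<open>D\<close> or kills the vector.\<close>

lemma stably_balanced_subgroup_proj:
  assumes x: "x \<in> stably_balanced q" and D: "D \<in> lcosets H"
  shows "subgroup_proj D x \<in> stably_balanced q"
proof -
  have bal: "balanced q (observe Cs x)" if "Cs \<in> lists (lcosets H)" for Cs
    using x that by (rule stably_balancedD)
  have zero: "balanced q (\<lambda>g. 0)" by (simp add: balanced_def)
  have "balanced q (observe Cs (subgroup_proj D x))" if Cs: "Cs \<in> lists (lcosets H)" for Cs
  proof (cases Cs)
    case Nil
    show ?thesis
      using bal[of "[]"] sum_subgroup_proj[OF _ D, of _ x] sum_subgroup_proj[OF _ D, of _ x "\<lambda>_. 1"]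
      by (simp add: Nil balanced_def)
  next
    case (Cons C Cs')
    then show ?thesis
      using Cs bal[of Cs] D zero by (auto simp: step_subgroup_proj observe_zero)
  qed
  moreover have "subgroup_proj D x \<in> carrier (group_algebra G)"
    using x by (auto simp: stably_balanced_def group_algebra_carrier subgroup_proj_def)
  ultimately show ?thesis by (simp add: stably_balanced_def)
qed

lemma jump_translate:
  assumes "g \<in> carrier G" "a \<in> carrier G" "D \<in> lcosets H"
  shows "jump (g \<otimes> a) (g <# D) = jump a D"
  unfolding jump_def sum_translate_coset[OF assms(1) coset_subset[OF assms(3)]]
  using assms coset_subset[OF assms(3)]
  by (intro sum.cong refl) (simp add: step_increment_translate subset_iff)

lemma mean_jump_translate:
  assumes "g \<in> carrier G" "C \<in> lcosets H" "D \<in> lcosets H"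
  shows "mean_jump (g <# C) (g <# D) = mean_jump C D"
proof -
  have "(\<Sum>a\<in>C. jump (g \<otimes> a) (g <# D)) = (\<Sum>a\<in>C. jump a D)"
    using assms coset_subset[OF assms(2)]
    by (intro sum.cong refl) (simp add: jump_translate subset_iff)
  then show ?thesis
    by (simp add: mean_jump_def sum_translate_coset assms coset_subset)
qed

lemma step_translate:
  assumes g: "g \<in> carrier G" and C: "C \<in> lcosets H"
  shows "step C (translate g x) = translate g (step (inv g <# C) x)"
proof
  fix y
  have C': "inv g <# C \<in> lcosets H" using g C by (simp add: translate_coset)
  show "step C (translate g x) y = translate g (step (inv g <# C) x) y"
  proof (cases "y \<in> carrier G")
    case True
    have "translate g (step (inv g <# C) x) y
        = (\<Sum>a\<in>C. x (inv g \<otimes> a) * of_real (w (inv (inv g \<otimes> a) \<otimes> (inv g \<otimes> y))))"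
      using True g C C' by (simp add: translate_def step_apply sum_translate_coset coset_subset)
    also have "\<dots> = (\<Sum>a\<in>C. translate g x a * of_real (w (inv a \<otimes> y)))"
      using True g coset_subset[OF C]
      by (intro sum.cong refl) (auto simp: translate_def step_increment_translate subset_iff)
    finally show ?thesis using True C by (simp add: step_apply)
  qed (simp add: step_apply[OF C] translate_def)
qed

lemma observe_translate:
  assumes "g \<in> carrier G" "Cs \<in> lists (lcosets H)"
  shows "observe Cs (translate g x) = translate g (observe (map (\<lambda>C. inv g <# C) Cs) x)"
  using assms(2) by (induction Cs arbitrary: x) (auto simp: step_translate assms(1))

lemma balanced_mean_jump_translate:
  assumes g: "g \<in> carrier G" and x: "balanced mean_jump x"
  shows "balanced mean_jump (translate g x)"
  unfolding balanced_def
proof (intro ballI)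
  fix C D assume C: "C \<in> lcosets H" and D: "D \<in> lcosets H"
  define C' D' where "C' = inv g <# C" and "D' = inv g <# D"
  have C': "C' \<in> lcosets H" "C = g <# C'" and D': "D' \<in> lcosets H" "D = g <# D'"
    using g C D by (simp_all add: C'_def D'_def translate_coset translate_inv_coset)
  have tr: "translate g x (g \<otimes> a) = x a" if "a \<in> C'" for a
    using that g coset_subset[OF C'(1)] by (auto simp: translate_def simp flip: m_assoc)
  have "(\<Sum>a\<in>C. translate g x a * of_real (jump a D)) = (\<Sum>a\<in>C'. x a * of_real (jump a D'))"
    unfolding C'(2) D'(2) sum_translate_coset[OF g coset_subset[OF C'(1)]]
    by (rule sum.cong) (use tr g coset_subset[OF C'(1)] D' in \<open>auto simp: jump_translate subset_iff\<close>)
  moreover have "(\<Sum>a\<in>C. translate g x a) = (\<Sum>a\<in>C'. x a)"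
    unfolding C'(2) sum_translate_coset[OF g coset_subset[OF C'(1)]] by (simp add: tr)
  moreover have "mean_jump C D = mean_jump C' D'"
    using g C' D' by (simp add: mean_jump_translate)
  ultimately show "(\<Sum>a\<in>C. translate g x a * of_real (jump a D))
      = (\<Sum>a\<in>C. translate g x a) * of_real (mean_jump C D)"
    using x C' D' by (simp add: balanced_def)
qed

text \<open>Translating a vector by \<open>g\<close> is the same as translating back all the cosets that are observed.
  For a general \<open>q\<close> this can destroy balance; it preserves it for \<open>mean_jump\<close>, which is invariant.\<close>

lemma stably_balanced_left_mult:
  assumes x: "x \<in> stably_balanced mean_jump"
  shows "a \<otimes>\<^bsub>group_algebra G\<^esub> x \<in> stably_balanced mean_jump"
proof -
  have "translate g x \<in> stably_balanced mean_jump" if g: "g \<in> carrier G" for g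
  proof -
    have "balanced mean_jump (observe Cs (translate g x))" if Cs: "Cs \<in> lists (lcosets H)" for Cs
    proof -
      have "map (\<lambda>C. inv g <# C) Cs \<in> lists (lcosets H)"
        using Cs g by (auto simp: translate_coset)
      then show ?thesis
        unfolding observe_translate[OF g Cs]
        by (intro balanced_mean_jump_translate[OF g] stably_balancedD[OF x])
    qed
    then show ?thesis by (auto simp: stably_balanced_def group_algebra_carrier translate_def)
  qed
  then show ?thesis
    unfolding left_mult_eq_sum_translates
    by (intro linear_closed_sum[OF linear_closed_stably_balanced finite_carrier]) auto
qed

end

section \<open>Gurvits-Ledoux ideals\<close>

lemma (in group) left_idealI_linear:
  assumes fin: "finite (carrier G)"
    and LA: "L \<subseteq> carrier (group_algebra G)" and lin: "linear_closed L"
    and absorb: "\<And>a x. a \<in> carrier (group_algebra G) \<Longrightarrow> x \<in> L \<Longrightarrow> a \<otimes>\<^bsub>group_algebra G\<^esub> x \<in> L"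
  shows "left_ideal L (group_algebra G)"
proof -
  interpret A: ring "group_algebra G" by (rule ring_group_algebra[OF fin])
  have add: "x \<oplus>\<^bsub>group_algebra G\<^esub> y \<in> L" if "x \<in> L" "y \<in> L" for x y
    using linear_closedD[OF lin that, of 1 1] by (simp add: group_algebra_def)
  have neg: "\<ominus>\<^bsub>group_algebra G\<^esub> x \<in> L" if "x \<in> L" for x
  proof -
    have "\<ominus>\<^bsub>group_algebra G\<^esub> \<one>\<^bsub>group_algebra G\<^esub> \<otimes>\<^bsub>group_algebra G\<^esub> x \<in> L"
      using that by (intro absorb) auto
    then show ?thesis using that LA by (simp add: A.l_minus subset_iff)
  qed
  have zero: "\<zero>\<^bsub>group_algebra G\<^esub> \<in> L"
    using lin by (simp add: linear_closed_def group_algebra_def)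
  show ?thesis
    by (intro left_ideal.intro additive_subgroup.intro left_ideal_axioms.intro A.ring_axioms
        A.add.subgroupI LA) (use zero add neg absorb in \<open>auto simp: a_inv_def\<close>)
qed

text \<open>Scalars act as left multiplication by the corresponding multiples of the unit.\<close>

lemma (in group) left_ideal_linear_closed:
  assumes L: "left_ideal L (group_algebra G)"
  shows "linear_closed L"
proof -
  interpret L: left_ideal L "group_algebra G" by (rule L)
  have smult: "(\<lambda>g. c * x g) \<in> L" if x: "x \<in> L" for x c
  proof -
    define s where "s = (\<lambda>g. c * \<one>\<^bsub>group_algebra G\<^esub> g)"
    have s: "s \<in> carrier (group_algebra G)"
      by (auto simp: s_def group_algebra_def)
    have "s \<otimes>\<^bsub>group_algebra G\<^esub> x = (\<lambda>g. c * (\<one>\<^bsub>group_algebra G\<^esub> \<otimes>\<^bsub>group_algebra G\<^esub> x) g)"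
      by (auto simp: group_algebra_mult s_def sum_distrib_left mult.assoc)
    also have "\<dots> = (\<lambda>g. c * x g)"
      using x by (simp add: L.a_Hcarr)
    finally show ?thesis using L.I_l_closed[OF x s] by simp
  qed
  have add: "(\<lambda>g. x g + y g) \<in> L" if "x \<in> L" "y \<in> L" for x y
    using additive_subgroup.a_closed[OF L.additive_subgroup_axioms that] by (simp add: group_algebra_def)
  show ?thesis
    unfolding linear_closed_def
    using additive_subgroup.zero_closed[OF L.additive_subgroup_axioms] add smult
    by (simp add: group_algebra_def)
qed

context coset_walk
begin

lemma H_in_cosets: "H \<in> lcosets H"
  using l_coset_in_cosets[of "\<one>"] lcos_mult_one[OF subgroup.subset[OF subgroup_H]] by simp

lemma gurvits_ledouxD:
  assumes "gurvits_ledoux_ideal G H w L"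
  shows "L \<subseteq> carrier (group_algebra G)" "linear_closed L"
    and "\<And>a x. a \<in> carrier (group_algebra G) \<Longrightarrow> x \<in> L \<Longrightarrow> a \<otimes>\<^bsub>group_algebra G\<^esub> x \<in> L"
    and "\<And>x. x \<in> L \<Longrightarrow> subgroup_proj H x \<in> L" "eta (carrier G) \<in> L"
    and "\<And>x. x \<in> L \<Longrightarrow> x \<otimes>\<^bsub>group_algebra G\<^esub> algebra_elem G w \<in> L"
proof -
  have L: "left_ideal L (group_algebra G)"
    using assms by (simp add: gurvits_ledoux_ideal_def)
  then interpret L: left_ideal L "group_algebra G" .
  show "L \<subseteq> carrier (group_algebra G)" using L.a_subset .
  show "linear_closed L" by (rule left_ideal_linear_closed[OF L])
  show "a \<otimes>\<^bsub>group_algebra G\<^esub> x \<in> L" if "a \<in> carrier (group_algebra G)" "x \<in> L" for a x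
    using L.I_l_closed that by simp
  show "subgroup_proj H x \<in> L" if "x \<in> L" for x
    using assms that by (auto simp: gurvits_ledoux_ideal_def induced_from_def)
  show "eta (carrier G) \<in> L" using assms by (simp add: gurvits_ledoux_ideal_def)
  show "x \<otimes>\<^bsub>group_algebra G\<^esub> algebra_elem G w \<in> L" if "x \<in> L" for x
    using assms that by (auto simp: gurvits_ledoux_ideal_def r_coset_def)
qed

lemma gurvits_ledouxI:
  assumes "L \<subseteq> carrier (group_algebra G)" "linear_closed L"
    and "\<And>a x. a \<in> carrier (group_algebra G) \<Longrightarrow> x \<in> L \<Longrightarrow> a \<otimes>\<^bsub>group_algebra G\<^esub> x \<in> L"
    and "\<And>x. x \<in> L \<Longrightarrow> subgroup_proj H x \<in> L" "eta (carrier G) \<in> L"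
    and "\<And>x. x \<in> L \<Longrightarrow> x \<otimes>\<^bsub>group_algebra G\<^esub> algebra_elem G w \<in> L"
  shows "gurvits_ledoux_ideal G H w L"
  unfolding gurvits_ledoux_ideal_def induced_from_def r_coset_def
  using assms left_idealI_linear[OF finite_carrier assms(1,2,3)] by auto

lemma gurvits_ledoux_stably_balanced:
  assumes "eta (carrier G) \<in> stably_balanced mean_jump"
  shows "gurvits_ledoux_ideal G H w (stably_balanced mean_jump)"
proof (rule gurvits_ledouxI)
  show "stably_balanced mean_jump \<subseteq> carrier (group_algebra G)"
    by (auto simp: stably_balanced_def)
qed (use assms H_in_cosets in \<open>auto intro: linear_closed_stably_balanced stably_balanced_left_mult
    stably_balanced_subgroup_proj stably_balanced_mult_weight\<close>)

lemma gurvits_ledoux_whole_algebra: "gurvits_ledoux_ideal G H w (carrier (group_algebra G))"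
  by (rule gurvits_ledouxI)
    (auto simp: linear_closed_def group_algebra_carrier group_algebra_mult subgroup_proj_def eta_def)

lemma gurvits_ledoux_min_gl_ideal: "gurvits_ledoux_ideal G H w (min_gl_ideal G H \<alpha> w)"
proof (rule gurvits_ledouxI)
  show "min_gl_ideal G H \<alpha> w \<subseteq> carrier (group_algebra G)"
    using gurvits_ledoux_whole_algebra algebra_elem_carrier by (auto simp: min_gl_ideal_def)
  show "linear_closed (min_gl_ideal G H \<alpha> w)"
    using gurvits_ledouxD(2) by (simp add: min_gl_ideal_def linear_closed_def)
qed (auto simp: min_gl_ideal_def dest: gurvits_ledouxD(3-6))

lemma initial_in_min_gl_ideal: "algebra_elem G \<alpha> \<in> min_gl_ideal G H \<alpha> w"
  by (simp add: min_gl_ideal_def)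

lemma gurvits_ledoux_translate:
  assumes L: "gurvits_ledoux_ideal G H w L" and g: "g \<in> carrier G" and x: "x \<in> L"
  shows "translate g x \<in> L"
proof -
  define d where "d = (\<lambda>y. if y = g then 1 else 0 :: complex)"
  have "d \<otimes>\<^bsub>group_algebra G\<^esub> x = translate g x"
    unfolding left_mult_eq_sum_translates d_def
    using g finite_carrier by (simp add: if_distrib[of "\<lambda>c. c * _"] cong: if_cong)
  moreover have "d \<in> carrier (group_algebra G)"
    using g by (auto simp: d_def group_algebra_carrier)
  ultimately show ?thesis using gurvits_ledouxD(3)[OF L _ x] by metis
qed

text \<open>An ideal that is closed under the projection to \<open>H\<close> is closed under the projection to every
  left coset, by translating the coset to \<open>H\<close> and back.\<close>

lemma gurvits_ledoux_subgroup_proj: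
  assumes L: "gurvits_ledoux_ideal G H w L" and C: "C \<in> lcosets H" and x: "x \<in> L"
  shows "subgroup_proj C x \<in> L"
proof -
  obtain g where g: "g \<in> carrier G" "C = g <# H"
    using C by (auto simp: LCOSETS_def)
  have mem: "inv g \<otimes> y \<in> H \<longleftrightarrow> y \<in> C" if "y \<in> carrier G" for y
    using subgroup.lcos_module_rev[OF subgroup_H is_group g(1) that]
      subgroup.lcos_module_imp[OF subgroup_H is_group g(1)] g(2) by blast
  have "subgroup_proj C x = translate g (subgroup_proj H (translate (inv g) x))"
  proof
    fix y
    have "g \<otimes> (inv g \<otimes> y) = y" if "y \<in> carrier G"
      using that g by (simp flip: m_assoc)
    then show "subgroup_proj C x y = translate g (subgroup_proj H (translate (inv g) x)) y"
      using mem[of y] g(1) coset_subset[OF C] by (auto simp: subgroup_proj_def translate_def)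
  qed
  then show ?thesis
    using g(1) by (simp add: gurvits_ledoux_translate[OF L] gurvits_ledouxD(4)[OF L] x)
qed

lemma gurvits_ledoux_observe:
  assumes L: "gurvits_ledoux_ideal G H w L" and "x \<in> L" "Cs \<in> lists (lcosets H)"
  shows "observe Cs x \<in> L"
  using assms(3,2)
  by (induction Cs arbitrary: x)
    (auto simp: step_def intro: gurvits_ledouxD(6)[OF L] gurvits_ledoux_subgroup_proj[OF L])

lemma eta_H_in_gurvits_ledoux:
  assumes L: "gurvits_ledoux_ideal G H w L"
  shows "eta H \<in> L"
proof -
  let ?u = "subgroup_proj H (eta (carrier G))"
  define c where "c = of_nat (card (carrier G)) / (of_nat (card H) :: complex)"
  have "card (carrier G) \<noteq> 0" using finite_carrier by auto
  then have "eta H = (\<lambda>g. c * ?u g + 0 * ?u g)"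
    using subgroup.subset[OF subgroup_H] by (auto simp: eta_def subgroup_proj_def c_def fun_eq_iff)
  also have "\<dots> \<in> L"
    using gurvits_ledouxD(4)[OF L gurvits_ledouxD(5)[OF L]]
    by (intro linear_closedD[OF gurvits_ledouxD(2)[OF L]])
  finally show ?thesis .
qed

section \<open>The ideal condition as a system of balance equations\<close>

lemma mult_eta_apply:
  assumes C: "C \<in> lcosets H" and y: "y \<in> C"
  shows "(x \<otimes>\<^bsub>group_algebra G\<^esub> eta H) y = (\<Sum>a\<in>C. x a) / of_nat (card H)"
proof -
  have yG: "y \<in> carrier G" using C y coset_subset by auto
  have "inv a \<otimes> y \<in> H \<longleftrightarrow> a \<in> C" if a: "a \<in> carrier G" for a
  proof -
    have "inv a \<otimes> y \<in> H \<longleftrightarrow> y \<in> a <# H"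
      using subgroup.lcos_module_rev[OF subgroup_H is_group a yG]
        subgroup.lcos_module_imp[OF subgroup_H is_group a] by blast
    also have "\<dots> \<longleftrightarrow> a \<in> C"
      using coset_mem_iff[OF a C] coset_eq[OF y C] coset_eq[OF _ l_coset_in_cosets[OF a], of y] y
      by metis
    finally show ?thesis .
  qed
  then have "(\<Sum>a\<in>carrier G. x a * eta H (inv a \<otimes> y)) = (\<Sum>a\<in>C. x a / of_nat (card H))"
    by (intro sum.mono_neutral_cong_right)
      (use finite_carrier coset_subset[OF C] in \<open>auto simp: eta_def\<close>)
  then show ?thesis using yG by (simp add: group_algebra_mult sum_divide_distrib)
qed

lemma sum_mult_eta:
  assumes "C \<in> lcosets H"
  shows "(\<Sum>y\<in>C. (x \<otimes>\<^bsub>group_algebra G\<^esub> eta H) y) = (\<Sum>a\<in>C. x a)"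
  using card_H_pos by (simp add: mult_eta_apply[OF assms] card_coset[OF assms])

lemma mult_one_minus_eta:
  assumes x: "x \<in> carrier (group_algebra G)"
  shows "x \<otimes>\<^bsub>group_algebra G\<^esub> (\<one>\<^bsub>group_algebra G\<^esub> \<ominus>\<^bsub>group_algebra G\<^esub> eta H)
    = (\<lambda>g. 1 * x g + (- 1) * (x \<otimes>\<^bsub>group_algebra G\<^esub> eta H) g)"
proof -
  interpret A: ring "group_algebra G" by (rule ring_group_algebra[OF finite_carrier])
  have \<eta>: "eta H \<in> carrier (group_algebra G)"
    by (rule eta_carrier[OF subgroup.subset[OF subgroup_H]])
  have neg: "\<ominus>\<^bsub>group_algebra G\<^esub> z = (\<lambda>g. - z g)" if "z \<in> carrier (group_algebra G)" for z
    by (rule A.minus_equality) (use that in \<open>auto simp: group_algebra_def\<close>)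
  have "x \<otimes>\<^bsub>group_algebra G\<^esub> (\<one>\<^bsub>group_algebra G\<^esub> \<ominus>\<^bsub>group_algebra G\<^esub> eta H)
      = x \<oplus>\<^bsub>group_algebra G\<^esub> \<ominus>\<^bsub>group_algebra G\<^esub> (x \<otimes>\<^bsub>group_algebra G\<^esub> eta H)"
    using x \<eta> by (simp add: A.minus_eq A.r_distr A.r_minus)
  also have "\<dots> = (\<lambda>g. x g + - (x \<otimes>\<^bsub>group_algebra G\<^esub> eta H) g)"
    using x \<eta> by (simp add: neg) (simp add: group_algebra_def)
  finally show ?thesis by simp
qed

text \<open>Since \<open>\<eta>\<^sub>H \<in> L\<close>, multiplication by the idempotent \<open>1 - \<eta>\<^sub>H\<close> maps \<open>L\<close> into itself, so its
  image is the part of \<open>L\<close> that it fixes. These are the elements whose average over each coset is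
  \<open>0\<close>.\<close>

lemma mem_ideal_mult_one_minus_eta:
  assumes L: "gurvits_ledoux_ideal G H w L"
  shows "z \<in> L #>\<^bsub>group_algebra G\<^esub> (\<one>\<^bsub>group_algebra G\<^esub> \<ominus>\<^bsub>group_algebra G\<^esub> eta H) \<longleftrightarrow>
    z \<in> L \<and> (\<forall>D\<in>lcosets H. (\<Sum>y\<in>D. z y) = 0)"
proof (intro iffI conjI)
  assume "z \<in> L #>\<^bsub>group_algebra G\<^esub> (\<one>\<^bsub>group_algebra G\<^esub> \<ominus>\<^bsub>group_algebra G\<^esub> eta H)"
  then obtain x where x: "x \<in> L"
    and z: "z = x \<otimes>\<^bsub>group_algebra G\<^esub> (\<one>\<^bsub>group_algebra G\<^esub> \<ominus>\<^bsub>group_algebra G\<^esub> eta H)"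
    by (auto simp: r_coset_def)
  have xA: "x \<in> carrier (group_algebra G)" using x gurvits_ledouxD(1)[OF L] by auto
  have "x \<otimes>\<^bsub>group_algebra G\<^esub> eta H \<in> L"
    by (rule gurvits_ledouxD(3)[OF L xA eta_H_in_gurvits_ledoux[OF L]])
  then show "z \<in> L"
    unfolding z mult_one_minus_eta[OF xA] by (rule linear_closedD[OF gurvits_ledouxD(2)[OF L] x])
  show "\<forall>D\<in>lcosets H. (\<Sum>y\<in>D. z y) = 0"
    by (simp add: z mult_one_minus_eta[OF xA] sum_subtractf sum_mult_eta)
next
  assume z: "z \<in> L \<and> (\<forall>D\<in>lcosets H. (\<Sum>y\<in>D. z y) = 0)"
  have zA: "z \<in> carrier (group_algebra G)" using z gurvits_ledouxD(1)[OF L] by auto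
  have "(z \<otimes>\<^bsub>group_algebra G\<^esub> eta H) y = 0" for y
  proof (cases "y \<in> carrier G")
    case True
    then show ?thesis
      using mult_eta_apply[OF l_coset_in_cosets lcos_self[OF _ subgroup_H]] z
      by (simp add: l_coset_in_cosets)
  qed (simp add: group_algebra_mult)
  then have "z = z \<otimes>\<^bsub>group_algebra G\<^esub> (\<one>\<^bsub>group_algebra G\<^esub> \<ominus>\<^bsub>group_algebra G\<^esub> eta H)"
    by (simp add: mult_one_minus_eta[OF zA])
  then show "z \<in> L #>\<^bsub>group_algebra G\<^esub> (\<one>\<^bsub>group_algebra G\<^esub> \<ominus>\<^bsub>group_algebra G\<^esub> eta H)"
    using z by (auto simp: r_coset_def)
qed

text \<open>Replacing \<open>x\<close> by \<open>x \<eta>\<^sub>H\<close> keeps the coset masses and makes the flow out of each coset the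
  average one, so the mass that \<open>x (1 - \<eta>\<^sub>H) w\<close> puts on \<open>D\<close> adds up, over all cosets, by how much
  \<open>x\<close> fails to be balanced.\<close>

lemma sum_one_minus_eta_mult_weight:
  assumes x: "x \<in> carrier (group_algebra G)" and D: "D \<in> lcosets H"
  shows "(\<Sum>y\<in>D. (x \<otimes>\<^bsub>group_algebra G\<^esub> (\<one>\<^bsub>group_algebra G\<^esub> \<ominus>\<^bsub>group_algebra G\<^esub> eta H)
        \<otimes>\<^bsub>group_algebra G\<^esub> algebra_elem G w) y)
    = (\<Sum>C\<in>lcosets H. (\<Sum>a\<in>C. x a * of_real (jump a D)) - (\<Sum>a\<in>C. x a) * of_real (mean_jump C D))"
    (is "(\<Sum>y\<in>D. (?z \<otimes>\<^bsub>group_algebra G\<^esub> algebra_elem G w) y) = _")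
proof -
  have z: "?z \<in> carrier (group_algebra G)"
    by (simp add: group_algebra_carrier group_algebra_mult)
  have "(\<Sum>a\<in>C. ?z a * of_real (jump a D))
      = (\<Sum>a\<in>C. x a * of_real (jump a D)) - (\<Sum>a\<in>C. x a) * of_real (mean_jump C D)"
    if C: "C \<in> lcosets H" for C
  proof -
    have "(\<Sum>a\<in>C. ?z a * of_real (jump a D)) = (\<Sum>a\<in>C. x a * of_real (jump a D)
        - (\<Sum>a\<in>C. x a) / of_nat (card H) * of_real (jump a D))"
      by (rule sum.cong) (simp_all add: mult_one_minus_eta[OF x] mult_eta_apply[OF C] left_diff_distrib)
    also have "\<dots> = (\<Sum>a\<in>C. x a * of_real (jump a D))
        - (\<Sum>a\<in>C. x a) / of_nat (card H) * (\<Sum>a\<in>C. of_real (jump a D))"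
      by (simp add: sum_subtractf sum_distrib_left)
    also have "(\<Sum>a\<in>C. x a) / of_nat (card H) * (\<Sum>a\<in>C. of_real (jump a D))
        = (\<Sum>a\<in>C. x a) * of_real (mean_jump C D)"
      by (simp add: mean_jump_def)
    finally show ?thesis .
  qed
  moreover have "(\<Sum>y\<in>D. (?z \<otimes>\<^bsub>group_algebra G\<^esub> algebra_elem G w) y)
      = (\<Sum>C\<in>lcosets H. \<Sum>y\<in>D. step C ?z y)"
    unfolding mult_weight_eq_sum_steps[OF z] by (simp add: sum.swap[of _ D])
  ultimately show ?thesis by (simp add: sum_step D)
qed

lemma ideal_condition_iff_balanced:
  assumes L: "gurvits_ledoux_ideal G H w L"
  shows "L #>\<^bsub>group_algebra G\<^esub> (\<one>\<^bsub>group_algebra G\<^esub> \<ominus>\<^bsub>group_algebra G\<^esub> eta H)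
        #>\<^bsub>group_algebra G\<^esub> algebra_elem G w
      \<subseteq> L #>\<^bsub>group_algebra G\<^esub> (\<one>\<^bsub>group_algebra G\<^esub> \<ominus>\<^bsub>group_algebra G\<^esub> eta H)
    \<longleftrightarrow> (\<forall>x\<in>L. balanced mean_jump x)"
    (is "?K #>\<^bsub>group_algebra G\<^esub> algebra_elem G w \<subseteq> ?K \<longleftrightarrow> _")
proof -
  let ?z = "\<lambda>x. x \<otimes>\<^bsub>group_algebra G\<^esub> (\<one>\<^bsub>group_algebra G\<^esub> \<ominus>\<^bsub>group_algebra G\<^esub> eta H)
      \<otimes>\<^bsub>group_algebra G\<^esub> algebra_elem G w"
  have zL: "?z x \<in> L" if "x \<in> L" for x
  proof -
    have "x \<otimes>\<^bsub>group_algebra G\<^esub> (\<one>\<^bsub>group_algebra G\<^esub> \<ominus>\<^bsub>group_algebra G\<^esub> eta H) \<in> ?K"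
      using that by (auto simp: r_coset_def)
    then show ?thesis
      using gurvits_ledouxD(6)[OF L] mem_ideal_mult_one_minus_eta[OF L] by blast
  qed
  have "?K #>\<^bsub>group_algebra G\<^esub> algebra_elem G w \<subseteq> ?K \<longleftrightarrow> (\<forall>x\<in>L. ?z x \<in> ?K)"
    by (auto simp: r_coset_def)
  also have "\<dots> \<longleftrightarrow> (\<forall>x\<in>L. \<forall>D\<in>lcosets H. (\<Sum>y\<in>D. ?z x y) = 0)"
    using zL by (simp add: mem_ideal_mult_one_minus_eta[OF L])
  also have "\<dots> \<longleftrightarrow> (\<forall>x\<in>L. balanced mean_jump x)"
  proof (intro iffI ballI)
    fix x D assume bal: "\<forall>x\<in>L. balanced mean_jump x" and x: "x \<in> L" and D: "D \<in> lcosets H"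
    have xA: "x \<in> carrier (group_algebra G)" using x gurvits_ledouxD(1)[OF L] by auto
    show "(\<Sum>y\<in>D. ?z x y) = 0"
      unfolding sum_one_minus_eta_mult_weight[OF xA D]
      by (rule sum.neutral) (use bal x D in \<open>auto simp: balanced_def\<close>)
  next
    fix x assume zero: "\<forall>x\<in>L. \<forall>D\<in>lcosets H. (\<Sum>y\<in>D. ?z x y) = 0" and x: "x \<in> L"
    show "balanced mean_jump x"
      unfolding balanced_def
    proof (intro ballI)
      fix C D assume C: "C \<in> lcosets H" and D: "D \<in> lcosets H"
      \<comment> \<open>Only the defect of \<open>C\<close> survives in the sum for the restriction of \<open>x\<close> to \<open>C\<close>.\<close>
      let ?x = "subgroup_proj C x"
      have xL: "?x \<in> L" by (rule gurvits_ledoux_subgroup_proj[OF L C x])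
      then have xA: "?x \<in> carrier (group_algebra G)" using gurvits_ledouxD(1)[OF L] by auto
      have "(\<Sum>C'\<in>lcosets H. (\<Sum>a\<in>C'. ?x a * of_real (jump a D))
          - (\<Sum>a\<in>C'. ?x a) * of_real (mean_jump C' D)) = 0"
        using zero xL D sum_one_minus_eta_mult_weight[OF xA D] by simp
      moreover have "(\<Sum>a\<in>C'. ?x a * of_real (jump a D)) - (\<Sum>a\<in>C'. ?x a) * of_real (mean_jump C' D)
          = (if C' = C then (\<Sum>a\<in>C. x a * of_real (jump a D))
              - (\<Sum>a\<in>C. x a) * of_real (mean_jump C D) else 0)"
        if "C' \<in> lcosets H" for C'
        using sum_subgroup_proj[OF that C, of x] sum_subgroup_proj[OF that C, of x "\<lambda>_. 1"] by simp
      ultimately show "(\<Sum>a\<in>C. x a * of_real (jump a D)) = (\<Sum>a\<in>C. x a) * of_real (mean_jump C D)"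
        using C finite_cosets by (simp cong: sum.cong)
    qed
  qed
  finally show ?thesis .
qed

text \<open>The uniform distribution charges every coset, so each of its balance equations can be solved
  for \<open>q C D\<close>.\<close>

lemma mean_jump_eq_of_uniform_balanced:
  assumes bal: "balanced q (eta (carrier G))" and C: "C \<in> lcosets H" and D: "D \<in> lcosets H"
  shows "mean_jump C D = q C D"
proof -
  let ?n = "of_nat (card (carrier G)) :: complex"
  have n: "?n \<noteq> 0" using finite_carrier by auto
  have \<eta>: "eta (carrier G) a = 1 / ?n" if "a \<in> C" for a
    using that coset_subset[OF C] by (auto simp: eta_def)
  have "(\<Sum>a\<in>C. of_real (jump a D)) / ?n = of_nat (card H) / ?n * complex_of_real (q C D)"
  proof -
    have "(\<Sum>a\<in>C. eta (carrier G) a * of_real (jump a D))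
        = (\<Sum>a\<in>C. eta (carrier G) a) * of_real (q C D)"
      using bal C D by (simp add: balanced_def)
    then show ?thesis by (simp add: \<eta> card_coset[OF C] sum_divide_distrib)
  qed
  then have "complex_of_real (\<Sum>a\<in>C. jump a D) = of_real (card H * q C D)"
    using n by (simp add: field_simps)
  then have "(\<Sum>a\<in>C. jump a D) = card H * q C D"
    by (simp only: of_real_eq_iff)
  then show ?thesis using card_H_pos by (simp add: mean_jump_def)
qed

lemma balanced_cong:
  assumes "\<And>C D. C \<in> lcosets H \<Longrightarrow> D \<in> lcosets H \<Longrightarrow> q C D = q' C D"
  shows "balanced q = balanced q'"
  using assms by (simp add: balanced_def fun_eq_iff)

lemma sum_jump:
  assumes "a \<in> carrier G"
  shows "(\<Sum>D\<in>lcosets H. jump a D) = (\<Sum>g\<in>carrier G. w g)"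
  using sum_inv_translate[OF finite_carrier assms, of w]
    sum_over_cosets[of "\<lambda>y. w (inv a \<otimes> y)"] by (simp add: jump_def)

lemma sum_mean_jump:
  assumes C: "C \<in> lcosets H"
  shows "(\<Sum>D\<in>lcosets H. mean_jump C D) = (\<Sum>g\<in>carrier G. w g)"
proof -
  have "(\<Sum>D\<in>lcosets H. \<Sum>a\<in>C. jump a D) = (\<Sum>a\<in>C. \<Sum>D\<in>lcosets H. jump a D)"
    by (rule sum.swap)
  also have "\<dots> = (\<Sum>a\<in>C. \<Sum>g\<in>carrier G. w g)"
    by (rule sum.cong) (use coset_subset[OF C] sum_jump in auto)
  finally show ?thesis
    using card_H_pos by (simp add: mean_jump_def card_coset[OF C] flip: sum_divide_distrib)
qed

end

section \<open>The law of the walk given the cosets visited\<close>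

context homogeneous_markov_chain
begin

lemma event_value [measurable]: "{\<omega> \<in> space M. Z t \<omega> = x} \<in> events"
proof -
  have "Z t -` ({x} \<inter> S) \<inter> space M \<in> events"
    using measurable_Z by (rule measurable_sets) simp
  moreover have "{\<omega> \<in> space M. Z t \<omega> = x} = Z t -` ({x} \<inter> S) \<inter> space M"
    using measurable_space[OF measurable_Z, of _ t] by auto
  ultimately show ?thesis by simp
qed

lemma event_in_set [measurable]: "{\<omega> \<in> space M. Z t \<omega> \<in> A} \<in> events"
proof -
  have "Z t -` (A \<inter> S) \<inter> space M \<in> events"
    using measurable_Z by (rule measurable_sets) simp
  moreover have "{\<omega> \<in> space M. Z t \<omega> \<in> A} = Z t -` (A \<inter> S) \<inter> space M"
    using measurable_space[OF measurable_Z, of _ t] by auto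
  ultimately show ?thesis by simp
qed

lemma prob_split_value:
  assumes E: "{\<omega> \<in> space M. E \<omega>} \<in> events" and A: "A \<subseteq> S"
  shows "prob {\<omega> \<in> space M. E \<omega> \<and> Z k \<omega> \<in> A} = (\<Sum>a\<in>A. prob {\<omega> \<in> space M. E \<omega> \<and> Z k \<omega> = a})"
proof -
  have "prob (\<Union>a\<in>A. {\<omega> \<in> space M. E \<omega> \<and> Z k \<omega> = a})
      = (\<Sum>a\<in>A. prob {\<omega> \<in> space M. E \<omega> \<and> Z k \<omega> = a})"
    using E finite_subset[OF A finite_states]
    by (intro finite_measure_finite_Union) (auto simp: disjoint_family_on_def)
  moreover have "(\<Union>a\<in>A. {\<omega> \<in> space M. E \<omega> \<and> Z k \<omega> = a}) = {\<omega> \<in> space M. E \<omega> \<and> Z k \<omega> \<in> A}"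
    by auto
  ultimately show ?thesis by simp
qed

text \<open>Multiplying out the conditional probability also covers pasts of probability \<open>0\<close>.\<close>

lemma markov_path:
  assumes y: "y \<in> S"
  shows "prob {\<omega> \<in> space M. (\<forall>i\<le>t. Z i \<omega> = h i) \<and> Z (Suc t) \<omega> = y}
    = prob {\<omega> \<in> space M. \<forall>i\<le>t. Z i \<omega> = h i} * P (h t) y"
proof (cases "prob {\<omega> \<in> space M. \<forall>i\<le>t. Z i \<omega> = h i} = 0")
  case True
  have "prob {\<omega> \<in> space M. (\<forall>i\<le>t. Z i \<omega> = h i) \<and> Z (Suc t) \<omega> = y}
      \<le> prob {\<omega> \<in> space M. \<forall>i\<le>t. Z i \<omega> = h i}"
    by (intro finite_measure_mono) auto
  then show ?thesis using True measure_nonneg[of M] by (simp add: antisym)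
next
  case False
  then have pos: "prob {\<omega> \<in> space M. \<forall>i\<le>t. Z i \<omega> = h i} > 0"
    using measure_nonneg[of M] by (simp add: less_le)
  show ?thesis
    using markov[OF pos y] False by (simp add: cond_prob_def field_simps conj_commute)
qed

text \<open>The Markov property for pasts given only by sets of states, as long as the present state is
  known. The constraints are relaxed from single states to sets one time at a time, each time by
  summing over the values.\<close>

lemma markov_box:
  assumes A: "\<And>i. i < k \<Longrightarrow> A i \<subseteq> S" and k: "k \<le> t" and y: "y \<in> S"
  shows "prob {\<omega> \<in> space M. (\<forall>i<k. Z i \<omega> \<in> A i) \<and> (\<forall>i\<in>{k..t}. Z i \<omega> = h i) \<and> Z (Suc t) \<omega> = y}
    = prob {\<omega> \<in> space M. (\<forall>i<k. Z i \<omega> \<in> A i) \<and> (\<forall>i\<in>{k..t}. Z i \<omega> = h i)} * P (h t) y"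
  using A k
proof (induction k arbitrary: h)
  case 0
  then show ?case
    using markov_path[OF y, of t h] by (simp add: Ball_def)
next
  case (Suc k)
  let ?E = "\<lambda>\<omega>. (\<forall>i<k. Z i \<omega> \<in> A i) \<and> (\<forall>i\<in>{Suc k..t}. Z i \<omega> = h i)"
  let ?h = "\<lambda>a. h(k := a)"
  have split: "(\<forall>i<Suc k. Z i \<omega> \<in> A i) \<longleftrightarrow> (\<forall>i<k. Z i \<omega> \<in> A i) \<and> Z k \<omega> \<in> A k" for \<omega>
    by (auto simp: less_Suc_eq)
  have upd: "(\<forall>i\<in>{k..t}. Z i \<omega> = ?h a i) \<longleftrightarrow> (\<forall>i\<in>{Suc k..t}. Z i \<omega> = h i) \<and> Z k \<omega> = a" for \<omega> a
  proof -
    have "{k..t} = insert k {Suc k..t}" using Suc.prems by auto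
    then show ?thesis by auto
  qed
  have Ak: "A k \<subseteq> S" using Suc.prems by simp
  have IH: "prob {\<omega> \<in> space M. (?E \<omega> \<and> Z (Suc t) \<omega> = y) \<and> Z k \<omega> = a}
      = prob {\<omega> \<in> space M. ?E \<omega> \<and> Z k \<omega> = a} * P (h t) y" for a
    using Suc.IH[of "?h a"] Suc.prems unfolding upd by (simp add: conj_ac)
  have "prob {\<omega> \<in> space M. (?E \<omega> \<and> Z (Suc t) \<omega> = y) \<and> Z k \<omega> \<in> A k}
      = prob {\<omega> \<in> space M. ?E \<omega> \<and> Z k \<omega> \<in> A k} * P (h t) y"
  proof -
    have "prob {\<omega> \<in> space M. (?E \<omega> \<and> Z (Suc t) \<omega> = y) \<and> Z k \<omega> \<in> A k}
        = (\<Sum>a\<in>A k. prob {\<omega> \<in> space M. (?E \<omega> \<and> Z (Suc t) \<omega> = y) \<and> Z k \<omega> = a})"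
      by (rule prob_split_value[OF _ Ak]) measurable
    also have "\<dots> = (\<Sum>a\<in>A k. prob {\<omega> \<in> space M. ?E \<omega> \<and> Z k \<omega> = a}) * P (h t) y"
      by (simp only: IH sum_distrib_right)
    also have "(\<Sum>a\<in>A k. prob {\<omega> \<in> space M. ?E \<omega> \<and> Z k \<omega> = a})
        = prob {\<omega> \<in> space M. ?E \<omega> \<and> Z k \<omega> \<in> A k}"
      by (rule prob_split_value[OF _ Ak, symmetric]) measurable
    finally show ?thesis .
  qed
  then show ?case unfolding split by (simp add: conj_ac)
qed

end

locale coset_walk_process = coset_walk G H w +
  homogeneous_markov_chain M "carrier G" "\<lambda>x y. w (inv x \<otimes> y) / (\<Sum>g\<in>carrier G. w g)" Z
  for G :: "('a, 'b) monoid_scheme" (structure) and H w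
    and M :: "'m measure" and Z +
  fixes \<alpha> :: "'a \<Rightarrow> real"
  assumes weight_w: "weight G w"
    and initial: "x \<in> carrier G \<Longrightarrow> prob {\<omega> \<in> space M. Z 0 \<omega> = x} = \<alpha> x"
begin

definition W :: real where "W = (\<Sum>g\<in>carrier G. w g)"

lemma W_pos: "0 < W"
  using weight_w finite_carrier
  by (force simp: weight_def W_def less_le sum_nonneg sum_nonneg_eq_0_iff)

definition visits :: "'a set list \<Rightarrow> 'm \<Rightarrow> bool"
  where "visits Cs \<omega> \<longleftrightarrow> (\<forall>i<length Cs. Z i \<omega> \<in> Cs ! i)"

lemma visits_snoc: "visits (Cs @ [C]) \<omega> \<longleftrightarrow> visits Cs \<omega> \<and> Z (length Cs) \<omega> \<in> C"
  by (auto simp: visits_def less_Suc_eq nth_append)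

lemma visits_event [measurable]: "{\<omega> \<in> space M. visits Cs \<omega>} \<in> events"
  unfolding visits_def by measurable

lemma visits_step:
  assumes Cs: "Cs \<in> lists (lcosets H)" and a: "a \<in> carrier G" and y: "y \<in> carrier G"
  shows "prob {\<omega> \<in> space M. (visits Cs \<omega> \<and> Z (Suc (length Cs)) \<omega> = y) \<and> Z (length Cs) \<omega> = a}
    = prob {\<omega> \<in> space M. visits Cs \<omega> \<and> Z (length Cs) \<omega> = a} * (w (inv a \<otimes> y) / W)"
proof -
  have "Cs ! i \<subseteq> carrier G" if "i < length Cs" for i
    using that Cs coset_subset[of "Cs ! i"] by auto
  from markov_box[of "length Cs" "(!) Cs" "length Cs" y "\<lambda>_. a", OF this _ y]
  show ?thesis
    by (simp add: visits_def W_def conj_ac)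
qed

text \<open>The factor \<open>W ^ length Cs\<close> undoes the normalisation of the weight in the transition matrix.\<close>

lemma observe_eq_path_probability:
  assumes "Cs \<in> lists (lcosets H)" "y \<in> carrier G"
  shows "observe Cs (algebra_elem G \<alpha>) y
    = of_real (W ^ length Cs * prob {\<omega> \<in> space M. visits Cs \<omega> \<and> Z (length Cs) \<omega> = y})"
  using assms
proof (induction Cs arbitrary: y rule: rev_induct)
  case Nil
  then show ?case by (simp add: visits_def initial algebra_elem_def)
next
  case (snoc C Cs)
  then have Cs: "Cs \<in> lists (lcosets H)" and C: "C \<in> lcosets H" by auto
  let ?p = "\<lambda>a. prob {\<omega> \<in> space M. visits Cs \<omega> \<and> Z (length Cs) \<omega> = a}"
  have "prob {\<omega> \<in> space M. (visits Cs \<omega> \<and> Z (Suc (length Cs)) \<omega> = y) \<and> Z (length Cs) \<omega> \<in> C}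
      = (\<Sum>a\<in>C. prob {\<omega> \<in> space M. (visits Cs \<omega> \<and> Z (Suc (length Cs)) \<omega> = y) \<and> Z (length Cs) \<omega> = a})"
    by (rule prob_split_value[OF _ coset_subset[OF C]]) measurable
  also have "\<dots> = (\<Sum>a\<in>C. ?p a * (w (inv a \<otimes> y) / W))"
    by (rule sum.cong[OF refl], rule visits_step[OF Cs]) (use coset_subset[OF C] snoc.prems in auto)
  finally have step_prob: "prob {\<omega> \<in> space M. visits (Cs @ [C]) \<omega> \<and> Z (Suc (length Cs)) \<omega> = y}
      = (\<Sum>a\<in>C. ?p a * w (inv a \<otimes> y)) / W"
    by (simp add: visits_snoc conj_ac sum_divide_distrib)
  have "observe (Cs @ [C]) (algebra_elem G \<alpha>) y
      = (\<Sum>a\<in>C. of_real (W ^ length Cs * ?p a) * of_real (w (inv a \<otimes> y)))"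
    using snoc.prems snoc.IH[OF Cs] coset_subset[OF C]
    by (simp add: observe_snoc step_apply[OF C] subset_iff)
  also have "\<dots> = of_real (W ^ length Cs * (\<Sum>a\<in>C. ?p a * w (inv a \<otimes> y)))"
    by (simp add: sum_distrib_left mult.assoc)
  also have "\<dots> = of_real (W ^ length (Cs @ [C])
      * prob {\<omega> \<in> space M. visits (Cs @ [C]) \<omega> \<and> Z (length (Cs @ [C])) \<omega> = y})"
    using W_pos by (simp add: step_prob)
  finally show ?case .
qed

lemma sum_observe_eq_visit_probability:
  assumes Cs: "Cs \<in> lists (lcosets H)" and C: "C \<in> lcosets H"
  shows "(\<Sum>a\<in>C. observe Cs (algebra_elem G \<alpha>) a)
    = of_real (W ^ length Cs * prob {\<omega> \<in> space M. visits (Cs @ [C]) \<omega>})"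
proof -
  have "(\<Sum>a\<in>C. observe Cs (algebra_elem G \<alpha>) a)
      = of_real (W ^ length Cs * (\<Sum>a\<in>C. prob {\<omega> \<in> space M. visits Cs \<omega> \<and> Z (length Cs) \<omega> = a}))"
    using coset_subset[OF C]
    by (simp add: observe_eq_path_probability[OF Cs] sum_distrib_left subset_iff)
  also have "(\<Sum>a\<in>C. prob {\<omega> \<in> space M. visits Cs \<omega> \<and> Z (length Cs) \<omega> = a})
      = prob {\<omega> \<in> space M. visits (Cs @ [C]) \<omega>}"
    unfolding visits_snoc
    by (rule prob_split_value[OF visits_event coset_subset[OF C], symmetric])
  finally show ?thesis .
qed

text \<open>Both sides of a balance equation for an observation of \<open>\<alpha>\<close> are rescaled probabilities of
  coset histories, of lengths that differ by one.\<close>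

lemma initial_stably_balanced_iff:
  "algebra_elem G \<alpha> \<in> stably_balanced q \<longleftrightarrow>
    (\<forall>Cs\<in>lists (lcosets H). \<forall>C\<in>lcosets H. \<forall>D\<in>lcosets H.
      prob {\<omega> \<in> space M. visits (Cs @ [C, D]) \<omega>}
        = prob {\<omega> \<in> space M. visits (Cs @ [C]) \<omega>} * (q C D / W))"
proof -
  have "(\<Sum>a\<in>C. observe Cs (algebra_elem G \<alpha>) a * of_real (jump a D))
        = (\<Sum>a\<in>C. observe Cs (algebra_elem G \<alpha>) a) * of_real (q C D)
      \<longleftrightarrow> prob {\<omega> \<in> space M. visits (Cs @ [C, D]) \<omega>}
        = prob {\<omega> \<in> space M. visits (Cs @ [C]) \<omega>} * (q C D / W)"
    if Cs: "Cs \<in> lists (lcosets H)" and C: "C \<in> lcosets H" and D: "D \<in> lcosets H" for Cs C D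
  proof -
    let ?p = "prob {\<omega> \<in> space M. visits (Cs @ [C]) \<omega>}"
    let ?p' = "prob {\<omega> \<in> space M. visits (Cs @ [C, D]) \<omega>}"
    have CsC: "Cs @ [C] \<in> lists (lcosets H)" using Cs C by simp
    have "(\<Sum>a\<in>C. observe Cs (algebra_elem G \<alpha>) a * of_real (jump a D))
        = of_real (W ^ Suc (length Cs) * ?p')"
      using sum_observe_eq_visit_probability[OF CsC D] by (simp add: observe_snoc sum_step C D)
    moreover have "(\<Sum>a\<in>C. observe Cs (algebra_elem G \<alpha>) a) * of_real (q C D)
        = of_real (W ^ length Cs * ?p * q C D)"
      by (simp add: sum_observe_eq_visit_probability[OF Cs C])
    moreover have "W ^ Suc (length Cs) * ?p' = W ^ length Cs * ?p * q C D \<longleftrightarrow> ?p' = ?p * (q C D / W)"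
      using W_pos by (simp add: field_simps)
    ultimately show ?thesis by (simp only: of_real_eq_iff)
  qed
  then show ?thesis
    by (simp add: stably_balanced_def balanced_def algebra_elem_carrier)
qed

lemma Z_carrier: "\<omega> \<in> space M \<Longrightarrow> Z t \<omega> \<in> carrier G"
  using measurable_space[OF measurable_Z] by auto

lemma visits_iff_cosets:
  assumes "\<omega> \<in> space M" "Cs \<in> lists (lcosets H)"
  shows "visits Cs \<omega> \<longleftrightarrow> (\<forall>i<length Cs. Z i \<omega> <# H = Cs ! i)"
proof -
  have "Z i \<omega> <# H = Cs ! i \<longleftrightarrow> Z i \<omega> \<in> Cs ! i" if "i < length Cs" for i
    using that assms Z_carrier by (intro coset_mem_iff) auto
  then show ?thesis by (simp add: visits_def)
qed

lemma visits_snoc_event: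
  assumes "Cs \<in> lists (lcosets H)" "C \<in> lcosets H"
  shows "{\<omega> \<in> space M. visits (Cs @ [C]) \<omega>}
    = {\<omega> \<in> space M. \<forall>i\<le>length Cs. Z i \<omega> <# H = (Cs @ [C]) ! i}"
proof (intro Collect_cong conj_cong refl)
  fix \<omega> assume "\<omega> \<in> space M"
  then show "visits (Cs @ [C]) \<omega> \<longleftrightarrow> (\<forall>i\<le>length Cs. Z i \<omega> <# H = (Cs @ [C]) ! i)"
    using visits_iff_cosets[of \<omega> "Cs @ [C]"] assms by (simp add: less_Suc_eq_le)
qed

lemma visits_snoc_snoc_event:
  assumes "Cs \<in> lists (lcosets H)" "C \<in> lcosets H" "D \<in> lcosets H"
  shows "{\<omega> \<in> space M. visits (Cs @ [C, D]) \<omega>}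
    = {\<omega> \<in> space M. (\<forall>i\<le>length Cs. Z i \<omega> <# H = (Cs @ [C]) ! i)
        \<and> Z (Suc (length Cs)) \<omega> <# H = D}"
proof (intro Collect_cong conj_cong refl)
  fix \<omega> assume \<omega>: "\<omega> \<in> space M"
  have "visits (Cs @ [C, D]) \<omega> \<longleftrightarrow> visits (Cs @ [C]) \<omega> \<and> Z (Suc (length Cs)) \<omega> \<in> D"
    using visits_snoc[of "Cs @ [C]" D] by simp
  also have "\<dots> \<longleftrightarrow> (\<forall>i\<le>length Cs. Z i \<omega> <# H = (Cs @ [C]) ! i) \<and> Z (Suc (length Cs)) \<omega> <# H = D"
    using visits_iff_cosets[of \<omega> "Cs @ [C]"] \<omega> assms
    by (simp add: less_Suc_eq_le coset_mem_iff Z_carrier)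
  finally show "visits (Cs @ [C, D]) \<omega> \<longleftrightarrow>
      (\<forall>i\<le>length Cs. Z i \<omega> <# H = (Cs @ [C]) ! i) \<and> Z (Suc (length Cs)) \<omega> <# H = D" .
qed

text \<open>A history of positive probability consists of cosets, so the Markov property of the lumped
  process involves exactly the coset histories of the previous lemmas.\<close>

lemma lumped_chain_iff:
  assumes Q0: "\<And>C D. C \<in> lcosets H \<Longrightarrow> D \<in> lcosets H \<Longrightarrow> 0 \<le> Q C D"
    and Q1: "\<And>C. C \<in> lcosets H \<Longrightarrow> (\<Sum>D\<in>lcosets H. Q C D) = 1"
  shows "homogeneous_markov_chain M (lcosets H) Q (\<lambda>t \<omega>. Z t \<omega> <# H) \<longleftrightarrow>
    algebra_elem G \<alpha> \<in> stably_balanced (\<lambda>C D. W * Q C D)"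
proof
  assume "homogeneous_markov_chain M (lcosets H) Q (\<lambda>t \<omega>. Z t \<omega> <# H)"
  then interpret Y: homogeneous_markov_chain M "lcosets H" Q "\<lambda>t \<omega>. Z t \<omega> <# H" .
  have "prob {\<omega> \<in> space M. visits (Cs @ [C, D]) \<omega>}
        = prob {\<omega> \<in> space M. visits (Cs @ [C]) \<omega>} * Q C D"
    if Cs: "Cs \<in> lists (lcosets H)" and C: "C \<in> lcosets H" and D: "D \<in> lcosets H" for Cs C D
  proof -
    show ?thesis
      using Y.markov_path[OF D, of "length Cs" "(!) (Cs @ [C])"]
      by (simp add: visits_snoc_event[OF Cs C] visits_snoc_snoc_event[OF Cs C D])
  qed
  then show "algebra_elem G \<alpha> \<in> stably_balanced (\<lambda>C D. W * Q C D)"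
    using W_pos by (simp add: initial_stably_balanced_iff)
next
  assume "algebra_elem G \<alpha> \<in> stably_balanced (\<lambda>C D. W * Q C D)"
  then have bal: "prob {\<omega> \<in> space M. visits (Cs @ [C, D]) \<omega>}
        = prob {\<omega> \<in> space M. visits (Cs @ [C]) \<omega>} * Q C D"
    if "Cs \<in> lists (lcosets H)" "C \<in> lcosets H" "D \<in> lcosets H" for Cs C D
    using that W_pos by (simp add: initial_stably_balanced_iff)
  show "homogeneous_markov_chain M (lcosets H) Q (\<lambda>t \<omega>. Z t \<omega> <# H)"
  proof unfold_locales
    show "(\<lambda>\<omega>. Z t \<omega> <# H) \<in> M \<rightarrow>\<^sub>M count_space (lcosets H)" for t
      by (rule measurable_compose[OF measurable_Z]) (simp add: l_coset_in_cosets)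
    fix t h D
    assume pos: "prob {\<omega> \<in> space M. \<forall>i\<le>t. Z i \<omega> <# H = h i} > 0" and D: "D \<in> lcosets H"
    have "{\<omega> \<in> space M. \<forall>i\<le>t. Z i \<omega> <# H = h i} \<noteq> {}"
      using pos by (metis measure_empty less_irrefl)
    then obtain \<omega> where \<omega>: "\<omega> \<in> space M" "\<forall>i\<le>t. Z i \<omega> <# H = h i" by blast
    have h: "h i \<in> lcosets H" if "i \<le> t" for i
      using l_coset_in_cosets[OF Z_carrier[OF \<omega>(1), of i]] \<omega>(2) that by simp
    define Cs where "Cs = map h [0..<t]"
    have Cs: "Cs \<in> lists (lcosets H)" "length Cs = t"
      using h by (auto simp: Cs_def)
    have ht: "h t \<in> lcosets H" by (simp add: h)
    have nth: "(Cs @ [h t]) ! i = h i" if "i \<le> t" for i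
      using that by (cases "i = t") (simp_all add: Cs_def nth_append)
    have "{\<omega> \<in> space M. visits (Cs @ [h t]) \<omega>} = {\<omega> \<in> space M. \<forall>i\<le>t. Z i \<omega> <# H = h i}"
      by (simp add: visits_snoc_event[OF Cs(1) ht] Cs(2) nth)
    moreover have "{\<omega> \<in> space M. visits (Cs @ [h t, D]) \<omega>}
        = {\<omega> \<in> space M. Z (Suc t) \<omega> <# H = D \<and> (\<forall>i\<le>t. Z i \<omega> <# H = h i)}"
      by (simp add: visits_snoc_snoc_event[OF Cs(1) ht D] Cs(2) nth conj_commute)
    ultimately show "cond_prob M (\<lambda>\<omega>. Z (Suc t) \<omega> <# H = D) (\<lambda>\<omega>. \<forall>i\<le>t. Z i \<omega> <# H = h i) = Q (h t) D"
      using bal[OF Cs(1) ht D] pos by (simp add: cond_prob_def)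
  qed (use finite_cosets Q0 Q1 in auto)
qed

end

section \<open>Weak lumping and the minimal ideal\<close>

context coset_walk_process
begin

lemma mean_jump_nonneg:
  assumes "C \<in> lcosets H" "D \<in> lcosets H"
  shows "0 \<le> mean_jump C D"
proof -
  have "0 \<le> w (inv a \<otimes> y)" if "a \<in> C" "y \<in> D" for a y
    using that assms coset_subset weight_w by (auto simp: weight_def subset_iff)
  then show ?thesis
    unfolding mean_jump_def jump_def by (intro divide_nonneg_nonneg sum_nonneg) auto
qed

lemma lumps_weakly_iff:
  assumes irr: "irreducible_weight G w" and \<alpha>: "(\<Sum>g\<in>carrier G. \<alpha> g) = 1"
  shows "lumps_weakly G H M Z \<longleftrightarrow> (\<forall>x\<in>min_gl_ideal G H \<alpha> w. balanced mean_jump x)"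
proof
  assume "lumps_weakly G H M Z"
  then obtain Q where Q: "homogeneous_markov_chain M (lcosets H) Q (\<lambda>t \<omega>. Z t \<omega> <# H)"
    by (auto simp: lumps_weakly_def)
  then interpret Y: homogeneous_markov_chain M "lcosets H" Q "\<lambda>t \<omega>. Z t \<omega> <# H" .
  let ?q = "\<lambda>C D. W * Q C D"
  have init: "algebra_elem G \<alpha> \<in> stably_balanced ?q"
    using Q Y.P_nonneg Y.P_sum by (subst (asm) lumped_chain_iff) auto
  \<comment> \<open>Balance passes from \<open>\<alpha>\<close> to the uniform distribution and thereby identifies
    \<open>W * Q C D\<close> with \<open>mean_jump C D\<close>.\<close>
  have \<eta>: "eta (carrier G) \<in> stably_balanced ?q"
  proof (rule uniform_distribution_in_closed_subspace[OF finite_carrier irr _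
        linear_closed_stably_balanced stably_balanced_mult_weight
        pointwise_closed_stably_balanced init])
    show "stably_balanced ?q \<subseteq> carrier (group_algebra G)" by (auto simp: stably_balanced_def)
    show "(\<Sum>g\<in>carrier G. algebra_elem G \<alpha> g) = 1"
      using \<alpha> by (simp add: algebra_elem_def flip: of_real_sum)
  qed
  then have "balanced ?q (eta (carrier G))"
    using stably_balancedD[OF \<eta>, of "[]"] by simp
  then have "balanced ?q = balanced mean_jump"
    by (intro balanced_cong) (simp add: mean_jump_eq_of_uniform_balanced)
  then have eq: "stably_balanced ?q = stably_balanced mean_jump"
    by (simp add: stably_balanced_def)
  have "gurvits_ledoux_ideal G H w (stably_balanced mean_jump)"
    using \<eta> by (intro gurvits_ledoux_stably_balanced) (simp add: eq)
  then have "min_gl_ideal G H \<alpha> w \<subseteq> stably_balanced mean_jump"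
    using init by (auto simp: min_gl_ideal_def eq)
  then show "\<forall>x\<in>min_gl_ideal G H \<alpha> w. balanced mean_jump x"
    using stably_balancedD[of _ mean_jump "[]"] by auto
next
  assume bal: "\<forall>x\<in>min_gl_ideal G H \<alpha> w. balanced mean_jump x"
  have init: "algebra_elem G \<alpha> \<in> stably_balanced mean_jump"
    using bal gurvits_ledoux_observe[OF gurvits_ledoux_min_gl_ideal initial_in_min_gl_ideal]
    by (simp add: stably_balanced_def algebra_elem_carrier)
  let ?Q = "\<lambda>C D. mean_jump C D / W"
  have "homogeneous_markov_chain M (lcosets H) ?Q (\<lambda>t \<omega>. Z t \<omega> <# H)"
  proof (subst lumped_chain_iff)
    show "0 \<le> ?Q C D" if "C \<in> lcosets H" "D \<in> lcosets H" for C D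
      using that mean_jump_nonneg W_pos by simp
    show "(\<Sum>D\<in>lcosets H. ?Q C D) = 1" if "C \<in> lcosets H" for C
      using that sum_mean_jump W_pos by (simp add: W_def flip: sum_divide_distrib)
    show "algebra_elem G \<alpha> \<in> stably_balanced (\<lambda>C D. W * ?Q C D)"
      using init W_pos by simp
  qed
  then show "lumps_weakly G H M Z"
    by (auto simp: lumps_weakly_def)
qed

end

theorem corollary1p5:
  fixes G :: "('a, 'b) monoid_scheme" and H :: "'a set"
    and w \<alpha> :: "'a \<Rightarrow> real"
    and M :: "'m measure" and Z :: "nat \<Rightarrow> 'm \<Rightarrow> 'a"
  assumes "group G" and "finite (carrier G)" and "subgroup H G"
    and "irreducible_weight G w" and "distribution_on G \<alpha>"
    and "is_MC G \<alpha> w M Z"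
  shows "lumps_weakly G H M Z \<longleftrightarrow>
    min_gl_ideal G H \<alpha> w
        #>\<^bsub>group_algebra G\<^esub> (\<one>\<^bsub>group_algebra G\<^esub> \<ominus>\<^bsub>group_algebra G\<^esub> eta H)
        #>\<^bsub>group_algebra G\<^esub> algebra_elem G w
      \<subseteq> min_gl_ideal G H \<alpha> w
        #>\<^bsub>group_algebra G\<^esub> (\<one>\<^bsub>group_algebra G\<^esub> \<ominus>\<^bsub>group_algebra G\<^esub> eta H)"
proof -
  interpret coset_walk G H w
    using assms by (intro coset_walk.intro coset_walk_axioms.intro)
  interpret coset_walk_process G H w M Z \<alpha>
    using assms
    by (intro coset_walk_process.intro coset_walk_axioms coset_walk_process_axioms.intro)
      (simp_all add: is_MC_def irreducible_weight_def)
  show ?thesis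
    using assms
    by (simp add: lumps_weakly_iff ideal_condition_iff_balanced[OF gurvits_ledoux_min_gl_ideal]
        distribution_on_def)
qed

end
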